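(* Consider linear maps $T,S:\mathcal{M}_3\to\mathcal{M}_3$. If the maps $T$, $S$, $\vartheta_3\circ T$ and $\vartheta_3\circ S$ are completely positive, then $$(T\otimes S)\left(\mathsf{PSD}(\mathbb{C}^3)\otimes_{\max}\mathsf{PSD}(\mathbb{C}^3)\right)\subseteq\mathsf{PSD}(\mathbb{C}^3)\otimes_{\min}\mathsf{PSD}(\mathbb{C}^3).$$
   Context: $\mathcal{M}_d$ is the set of complex $d\times d$ matrices, $\mathsf{PSD}(\mathbb{C}^d)$ the cone of positive semidefinite matrices, and $\vartheta_d:\mathcal{M}_d\to\mathcal{M}_d$ the transpose map in the computational (standard) basis. A linear map $P$ is completely positive if $\mathrm{id}_n\otimes P$ maps positive semidefinite matrices to positive semidefinite matrices for every $n\in\mathbb{N}$. Set $\mathsf{PSD}(\mathbb{C}^{3})\otimes_{\min}\mathsf{PSD}(\mathbb{C}^{3})=\mathrm{conv}\{x\otimes y: x,y\in\mathsf{PSD}(\mathbb{C}^3)\}$, and let $\mathsf{PSD}(\mathbb{C}^{3})\otimes_{\max}\mathsf{PSD}(\mathbb{C}^{3})$ be its dual cone with respect to the Hilbert–Schmidt inner product $\langle x,y\rangle=\mathrm{Tr}[xy]$ on the real space of self-adjoint elements of $\mathcal{M}_3\otimes\mathcal{M}_3$. *)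

theory Defs
  imports "HOL-Analysis.Analysis"
begin

text \<open>
  The space of complex \<open>d \<times> d\<close> matrices is \<open>complex^'d^'d\<close>. The tensor product of the matrix
  algebras over \<open>'a\<close> and \<open>'b\<close> is the matrix algebra over the index type \<open>'a \<times> 'b\<close>, with the
  Kronecker product as elementary tensor.
\<close>

definition cscale :: "complex \<Rightarrow> complex^'n^'m \<Rightarrow> complex^'n^'m" where
  "cscale c A = map_matrix ((*) c) A"

text \<open>The scalar multiplication \<open>scaleR\<close> of the type \<open>complex^'n^'m\<close> is real; complex linearity
  therefore refers to \<open>cscale\<close>.\<close>

abbreviation complex_linear :: "(complex^'a^'b \<Rightarrow> complex^'c^'d) \<Rightarrow> bool" where
  "complex_linear \<equiv> Vector_Spaces.linear cscale cscale"

definition hermitian :: "complex^'n^'n \<Rightarrow> bool" where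
  "hermitian A \<longleftrightarrow> transpose (map_matrix cnj A) = A"

text \<open>Positive semidefiniteness of the matrix with entries \<open>A i j\<close> for \<open>i, j \<in> I\<close>. Matrices over
  an index set rather than an index type are needed to let the size vary inside a formula. Since
  the matrix is self-adjoint, the quadratic form is real and \<open>Re\<close> loses nothing.\<close>

definition psd_on :: "'i set \<Rightarrow> ('i \<Rightarrow> 'i \<Rightarrow> complex) \<Rightarrow> bool" where
  "psd_on I A \<longleftrightarrow>
     (\<forall>i\<in>I. \<forall>j\<in>I. cnj (A j i) = A i j) \<and>
     (\<forall>v. 0 \<le> Re (\<Sum>i\<in>I. \<Sum>j\<in>I. cnj (v i) * A i j * v j))"

definition PSD :: "(complex^'n^'n) set" where
  "PSD = {A. psd_on UNIV (\<lambda>i j. A $ i $ j)}"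

text \<open>An element of \<open>M\<^sub>n \<otimes> M\<^sub>d\<close> is an \<open>n \<times> n\<close> array \<open>X\<close> of \<open>d \<times> d\<close> blocks, on
  which \<open>id\<^sub>n \<otimes> P\<close> acts blockwise (see \<open>tensor_map_id_block\<close> below). Linearity of \<open>P\<close> is
  not part of the definition.\<close>

definition completely_positive :: "(complex^'a^'a \<Rightarrow> complex^'b^'b) \<Rightarrow> bool" where
  "completely_positive P \<longleftrightarrow>
     (\<forall>(n::nat) (X :: nat \<Rightarrow> nat \<Rightarrow> complex^'a^'a).
        psd_on ({..<n} \<times> UNIV) (\<lambda>(i, a) (j, b). X i j $ a $ b) \<longrightarrow>
        psd_on ({..<n} \<times> UNIV) (\<lambda>(i, a) (j, b). P (X i j) $ a $ b))"

definition kron :: "complex^'a^'c \<Rightarrow> complex^'b^'d \<Rightarrow> complex^('a \<times> 'b)^('c \<times> 'd)" where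
  "kron A B = (\<chi> p q. A $ fst p $ fst q * B $ snd p $ snd q)"

definition mat_unit :: "'m \<Rightarrow> 'n \<Rightarrow> complex^'n^'m" where
  "mat_unit i j = (\<chi> a b. if a = i \<and> b = j then 1 else 0)"

text \<open>The tensor product of two complex linear maps, by linear extension from the basis
  of the elementary tensors of matrix units. That it is the unique linear map with
  \<open>A \<otimes> B \<mapsto> T A \<otimes> S B\<close> is \<open>tensor_map_unique\<close> below.\<close>

definition tensor_map ::
  "(complex^'a^'a \<Rightarrow> complex^'c^'c) \<Rightarrow> (complex^'b^'b \<Rightarrow> complex^'d^'d) \<Rightarrow>
   complex^('a \<times> 'b)^('a \<times> 'b) \<Rightarrow> complex^('c \<times> 'd)^('c \<times> 'd)" where
  "tensor_map T S X =
     (\<Sum>i\<in>UNIV. \<Sum>j\<in>UNIV. \<Sum>k\<in>UNIV. \<Sum>l\<in>UNIV.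
        cscale (X $ (i, k) $ (j, l)) (kron (T (mat_unit i j)) (S (mat_unit k l))))"

definition min_tensor ::
  "(complex^'a^'a) set \<Rightarrow> (complex^'b^'b) set \<Rightarrow> (complex^('a \<times> 'b)^('a \<times> 'b)) set" where
  "min_tensor C D = convex hull {kron x y | x y. x \<in> C \<and> y \<in> D}"

text \<open>The dual cone inside the real space of self-adjoint matrices. For self-adjoint \<open>x\<close>, \<open>y\<close>
  the trace of \<open>x ** y\<close> is real.\<close>

definition dual_cone :: "(complex^'n^'n) set \<Rightarrow> (complex^'n^'n) set" where
  "dual_cone C = {x. hermitian x \<and> (\<forall>y\<in>C. 0 \<le> Re (trace (x ** y)))}"

text \<open>The maximal tensor product is in general the dual of the minimal tensor product of the dual
  cones; the cone of positive semidefinite matrices is self-dual, so no dual is taken inside.\<close>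

definition PSD_max_tensor :: "(complex^('a::finite \<times> 'b::finite)^('a \<times> 'b)) set" where
  "PSD_max_tensor = dual_cone (min_tensor PSD PSD)"

lemma cscale_nth [simp]: "cscale c A $ i $ j = c * A $ i $ j"
  by (simp add: cscale_def)

lemma vector_space_cscale: "vector_space (cscale :: complex \<Rightarrow> complex^'n^'m \<Rightarrow> _)"
  by unfold_locales (simp_all add: vec_eq_iff algebra_simps)

lemma complex_linear_iff:
  "complex_linear f \<longleftrightarrow> (\<forall>A B. f (A + B) = f A + f B) \<and> (\<forall>c A. f (cscale c A) = cscale c (f A))"
  by (simp add: Vector_Spaces.linear_iff vector_space_cscale)

lemma complex_linear_sum:
  assumes "complex_linear f"
  shows "f (sum g I) = (\<Sum>i\<in>I. f (g i))"
proof -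
  interpret Vector_Spaces.linear cscale cscale f by (rule assms)
  show ?thesis by (rule sum)
qed

lemma kron_nth [simp]: "kron A B $ (a, b) $ (c, d) = A $ a $ c * B $ b $ d"
  by (simp add: kron_def)

lemma mat_unit_expansion: "A = (\<Sum>i\<in>UNIV. \<Sum>j\<in>UNIV. cscale (A $ i $ j) (mat_unit i j))"
proof -
  have "(\<Sum>i\<in>UNIV. \<Sum>j\<in>UNIV. A $ i $ j * (if a = i \<and> b = j then 1 else 0)) = A $ a $ b" for a b
  proof -
    have "(\<Sum>j\<in>UNIV. A $ i $ j * (if a = i \<and> b = j then 1 else 0))
        = (\<Sum>j\<in>UNIV. if j = b then if i = a then A $ i $ j else 0 else 0)" for i
      by (rule sum.cong) auto
    then show ?thesis by simp
  qed
  then show ?thesis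
    by (simp only: vec_eq_iff sum_component cscale_nth mat_unit_def vec_lambda_beta) simp
qed

lemma complex_linear_expansion:
  assumes "complex_linear f"
  shows "f A = (\<Sum>i\<in>UNIV. \<Sum>j\<in>UNIV. cscale (A $ i $ j) (f (mat_unit i j)))"
  using assms
  by (subst mat_unit_expansion) (simp add: complex_linear_sum complex_linear_iff)

lemma tensor_map_kron:
  assumes "complex_linear T" and "complex_linear S"
  shows "tensor_map T S (kron A B) = kron (T A) (S B)"
proof -
  have "kron (T A) (S B) $ (a, b) $ (c, d) = tensor_map T S (kron A B) $ (a, b) $ (c, d)" for a b c d
  proof -
    have "T A $ a $ c * S B $ b $ d =
       (\<Sum>i\<in>UNIV. \<Sum>j\<in>UNIV. A $ i $ j * T (mat_unit i j) $ a $ c) *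
       (\<Sum>k\<in>UNIV. \<Sum>l\<in>UNIV. B $ k $ l * S (mat_unit k l) $ b $ d)"
      by (subst complex_linear_expansion[OF assms(1)], subst complex_linear_expansion[OF assms(2)])
         simp
    also have "\<dots> = (\<Sum>i\<in>UNIV. \<Sum>j\<in>UNIV. \<Sum>k\<in>UNIV. \<Sum>l\<in>UNIV.
       A $ i $ j * B $ k $ l * (T (mat_unit i j) $ a $ c * S (mat_unit k l) $ b $ d))"
      by (simp only: sum_distrib_right, simp only: sum_distrib_left, simp only: mult_ac)
    finally show ?thesis by (simp add: tensor_map_def)
  qed
  then show ?thesis by (simp add: vec_eq_iff split_paired_all)
qed

lemma complex_linear_tensor_map: "complex_linear (tensor_map T S)"
  unfolding complex_linear_iff
  by (auto simp: tensor_map_def vec_eq_iff sum_distrib_left sum.distrib[symmetric] algebra_simps)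

lemma tensor_map_unique:
  fixes T :: "complex^'a^'a \<Rightarrow> complex^'c^'c" and S :: "complex^'b^'b \<Rightarrow> complex^'d^'d"
  assumes "complex_linear T" and "complex_linear S" and F: "complex_linear F"
    and "\<And>A B. F (kron A B) = kron (T A) (S B)"
  shows "F = tensor_map T S"
proof
  fix X
  have unit: "mat_unit (i, k) (j, l) = kron (mat_unit i j) (mat_unit k l)"
    for i j :: 'a and k l :: 'b
    by (auto simp: vec_eq_iff mat_unit_def kron_def)
  have eq: "F (mat_unit p q) = tensor_map T S (mat_unit p q)" for p q
    by (cases p; cases q) (simp add: unit tensor_map_kron assms)
  show "F X = tensor_map T S X"
    by (subst complex_linear_expansion[OF F],
        subst complex_linear_expansion[OF complex_linear_tensor_map]) (simp add: eq)
qed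

lemma tensor_map_id_block:
  assumes "complex_linear P"
  shows "tensor_map (\<lambda>A. A) P X $ (i, a) $ (j, b) = P (\<chi> k l. X $ (i, k) $ (j, l)) $ a $ b"
proof -
  have "tensor_map (\<lambda>A. A) P X $ (i, a) $ (j, b) =
     (\<Sum>i'\<in>UNIV. \<Sum>j'\<in>UNIV. if i' = i then if j' = j then
        (\<Sum>k\<in>UNIV. \<Sum>l\<in>UNIV. X $ (i', k) $ (j', l) * P (mat_unit k l) $ a $ b) else 0 else 0)"
    by (auto simp: tensor_map_def mat_unit_def intro!: sum.cong sum.neutral)
  also have "\<dots> = (\<Sum>i'\<in>UNIV. if i' = i then (\<Sum>j'\<in>UNIV. if j' = j then
        (\<Sum>k\<in>UNIV. \<Sum>l\<in>UNIV. X $ (i', k) $ (j', l) * P (mat_unit k l) $ a $ b) else 0) else 0)"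
    by (intro sum.cong refl) auto
  also have "\<dots> = (\<Sum>k\<in>UNIV. \<Sum>l\<in>UNIV. X $ (i, k) $ (j, l) * P (mat_unit k l) $ a $ b)"
    by simp
  also have "\<dots> = P (\<chi> k l. X $ (i, k) $ (j, l)) $ a $ b"
    by (subst complex_linear_expansion[OF assms]) simp
  finally show ?thesis .
qed

end

theory Submission
  imports Defs
begin

text \<open>
  The pairing of \<open>(T \<otimes> S)(x)\<close> with a block-positive \<open>z\<close> is the pairing of the Choi matrix of \<open>T\<close>
  with an array \<open>W\<close> depending on \<open>S\<close>, \<open>x\<close>, \<open>z\<close>. Restricting one factor to two dimensions, \<open>S\<close> being
  PPT and Woronowicz's theorem (PPT matrices of size 2 by 3 are separable), applied twice, show that
  \<open>W\<close> is nonnegative on vectors of Schmidt rank at most two. A Schur complement then splits \<open>W\<close> into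
  a positive semidefinite part and a block-positive part of size 2 by 3, and Woronowicz's theorem,
  applied to a corner of the PPT Choi matrix of \<open>T\<close>, makes the pairing nonnegative. As the minimal
  tensor product is a closed cone, this suffices.

  Woronowicz's theorem reduces to finding, for each nonzero PPT matrix, a product vector that can be
  subtracted from it. After normalising one corner to a projection, let \<open>B\<close> be the off-diagonal
  block and \<open>D\<close>, \<open>G\<close> the Schur complements of the matrix and of its partial transpose, so that
  \<open>adj B ** B + D = B ** adj B + G\<close>. If the ranges of \<open>D\<close> and \<open>G\<close> meet, a vector in both will do.
  Otherwise their ranks are \<open>(0, 0)\<close>, where \<open>B\<close> is normal; \<open>(1, 1)\<close>, where \<open>B\<close> has a normal dilation
  with one additional dimension; or \<open>(1, 2)\<close>, where Brouwer's theorem yields a root of the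
  determinant that decides the existence of a product vector.
\<close>

subsection \<open>Matrices and vectors\<close>

definition adj :: "complex^'n^'m \<Rightarrow> complex^'m^'n" where
  "adj A = transpose (map_matrix cnj A)"

text \<open>The operation \<open>\<bullet>\<close> on complex vectors is the real part of this form
  (\<open>Re_cip\<close>). Positivity is expressed with \<open>\<bullet>\<close>, complex
  orthogonality with \<open>cip\<close>.\<close>

definition cip :: "complex^'n \<Rightarrow> complex^'n \<Rightarrow> complex" where
  "cip u v = (\<Sum>i\<in>UNIV. cnj (u $ i) * v $ i)"

definition outer :: "complex^'m \<Rightarrow> complex^'n \<Rightarrow> complex^'n^'m" where
  "outer u v = (\<chi> i j. u $ i * cnj (v $ j))"

lemma adj_nth [simp]: "adj A $ i $ j = cnj (A $ j $ i)"
  by (simp add: adj_def transpose_def)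

lemma outer_nth [simp]: "outer u v $ i $ j = u $ i * cnj (v $ j)"
  by (simp add: outer_def)

lemma hermitian_iff_adj: "hermitian A \<longleftrightarrow> adj A = A"
  by (simp add: hermitian_def adj_def)

lemma adj_adj [simp]: "adj (adj A) = A"
  by (simp add: vec_eq_iff)

lemma adj_add: "adj (A + B) = adj A + adj B"
  and adj_diff: "adj (A - B) = adj A - adj B"
  and adj_scaleR: "adj (r *\<^sub>R A) = r *\<^sub>R adj A"
  and adj_0 [simp]: "adj 0 = 0"
  by (simp_all add: vec_eq_iff)

lemma adj_mat1 [simp]: "adj (mat 1) = mat 1"
  by (auto simp: vec_eq_iff mat_def)

lemma adj_mult: "adj (A ** B) = adj B ** adj A"
  by (simp add: vec_eq_iff matrix_matrix_mult_def mult.commute)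

lemma adj_outer [simp]: "adj (outer u v) = outer v u"
  by (simp add: vec_eq_iff mult.commute)

lemma linear_adj: "linear adj"
  by (rule linearI) (simp_all add: adj_add adj_scaleR)

lemma Re_cip: "Re (cip u v) = u \<bullet> v"
  by (simp add: cip_def inner_vec_def inner_complex_def)

lemma cip_commute: "cip v u = cnj (cip u v)"
  by (simp add: cip_def mult.commute)

lemma cip_self: "cip u u = complex_of_real ((norm u)\<^sup>2)"
proof -
  have "Im (cip u u) = 0" by (simp add: cip_def)
  moreover have "Re (cip u u) = (norm u)\<^sup>2" by (simp add: Re_cip power2_norm_eq_inner)
  ultimately show ?thesis by (simp add: complex_eq_iff)
qed

lemma cip_add_right: "cip u (v + w) = cip u v + cip u w"
  and cip_add_left: "cip (v + w) u = cip v u + cip w u"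
  and cip_diff_right: "cip u (v - w) = cip u v - cip u w"
  and cip_diff_left: "cip (v - w) u = cip v u - cip w u"
  and cip_scale_right: "cip u (c *s v) = c * cip u v"
  and cip_scale_left: "cip (c *s u) v = cnj c * cip u v"
  and cip_0_right [simp]: "cip u 0 = 0"
  and cip_0_left [simp]: "cip 0 u = 0"
  by (simp_all add: cip_def algebra_simps sum.distrib sum_subtractf sum_distrib_left)

lemmas cip_simps = cip_add_right cip_add_left cip_diff_right cip_diff_left cip_scale_right cip_scale_left

lemma scaleR_eq_scale: "r *\<^sub>R (v :: complex^'n) = complex_of_real r *s v"
  by (simp only: vec_eq_iff vector_scaleR_component vector_smult_component)
     (simp add: scaleR_conv_of_real)

lemma cip_adj: "cip u (A *v v) = cip (adj A *v u) v"
proof -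
  have "cip u (A *v v) = (\<Sum>i\<in>UNIV. \<Sum>j\<in>UNIV. cnj (u $ i) * A $ i $ j * v $ j)"
    by (simp add: cip_def matrix_vector_mult_def sum_distrib_left mult.assoc)
  also have "\<dots> = (\<Sum>j\<in>UNIV. \<Sum>i\<in>UNIV. cnj (u $ i) * A $ i $ j * v $ j)"
    by (rule sum.swap)
  also have "\<dots> = cip (adj A *v u) v"
    by (simp add: cip_def matrix_vector_mult_def sum_distrib_left sum_distrib_right mult_ac)
  finally show ?thesis .
qed

lemma inner_adj: "u \<bullet> (A *v v) = (adj A *v u) \<bullet> (v :: complex^'n)"
  by (metis Re_cip cip_adj)

lemma inner_imult: "(\<i> *s u) \<bullet> (v :: complex^'n) = - (u \<bullet> (\<i> *s v))"
  by (simp only: Re_cip[symmetric] cip_simps) simp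

lemma outer_vec: "outer u v *v w = cip v w *s u"
  by (simp add: vec_eq_iff matrix_vector_mult_def cip_def sum_distrib_left sum_distrib_right mult_ac)

lemma trace_outer: "trace (X ** outer u v) = cip v (X *v u)"
proof -
  have "trace (X ** outer u v) = (\<Sum>i\<in>UNIV. \<Sum>k\<in>UNIV. X $ i $ k * u $ k * cnj (v $ i))"
    by (simp add: trace_def matrix_matrix_mult_def mult.assoc)
  also have "\<dots> = cip v (X *v u)"
    by (simp add: cip_def matrix_vector_mult_def sum_distrib_left mult_ac)
  finally show ?thesis .
qed

lemma trace_outer_only: "trace (outer u v) = cip v u" for u v :: "complex^'n"
  using trace_outer[of "mat 1" u v] by simp

lemma trace_cyclic: "trace (A ** B) = trace (B ** A)" for A :: "complex^'n^'m"
  by (simp add: trace_def matrix_matrix_mult_def mult.commute) (rule sum.swap)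

lemma trace_adj: "trace (adj A) = cnj (trace A)"
  by (simp add: trace_def)

lemma outer_mult_right: "A ** outer u v = outer (A *v u) v"
  by (simp add: vec_eq_iff matrix_matrix_mult_def matrix_vector_mult_def sum_distrib_left mult_ac)

lemma outer_mult_left: "outer u v ** A = outer u (adj A *v v)"
  by (simp add: vec_eq_iff matrix_matrix_mult_def matrix_vector_mult_def sum_distrib_left mult_ac)

lemma matrix_eqI: "(\<And>v. A *v v = B *v v) \<Longrightarrow> A = B" for A :: "complex^'n^'m"
  by (simp add: matrix_eq)

lemma scaleR_matrix_vec: "(r *\<^sub>R A) *v v = r *\<^sub>R (A *v v)" for A :: "complex^'n^'m"
  by (simp add: vec_eq_iff matrix_vector_mult_def scaleR_right.sum)

lemma matrix_vec_scaleR: "A *v (r *\<^sub>R v) = r *\<^sub>R (A *v v)" for A :: "complex^'n^'m"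
  by (simp add: scaleR_eq_scale vector_scalar_commute)

lemma linear_matrix_vec [simp]: "linear ((*v) A)" for A :: "complex^'n^'m"
  by (rule linearI) (simp_all add: matrix_vector_right_distrib matrix_vec_scaleR)

text \<open>Real dimension count: the imaginary part of \<open>cip y x\<close> is the real product
  of \<open>\<i> *s y\<close> with \<open>x\<close>, so at most \<open>2 * card F\<close> real
  conditions are imposed.\<close>

lemma complex_orthogonal_exists:
  fixes F :: "(complex^'n) set"
  assumes "finite F" "card F < CARD('n)"
  obtains x where "x \<noteq> 0" "\<And>y. y \<in> F \<Longrightarrow> cip y x = 0"
proof -
  let ?G = "F \<union> (\<lambda>y. \<i> *s y) ` F"
  have "dim ?G \<le> card ?G" using assms(1) by (intro dim_le_card') auto
  also have "\<dots> \<le> card F + card F"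
    using card_Un_le card_image_le[OF assms(1)] add_left_mono le_trans by metis
  also have "\<dots> < DIM(complex^'n)" using assms(2) by simp
  finally obtain x where x: "x \<noteq> 0" "\<And>y. y \<in> span ?G \<Longrightarrow> orthogonal x y"
    using orthogonal_to_subspace_exists by metis
  have "cip y x = 0" if "y \<in> F" for y
  proof -
    have "y \<in> span ?G" "\<i> *s y \<in> span ?G" using that by (auto intro: span_base)
    then have "y \<bullet> x = 0" "(\<i> *s y) \<bullet> x = 0" using x(2) by (metis inner_commute orthogonal_def)+
    moreover have "Im (cip y x) = (\<i> *s y) \<bullet> x" by (simp only: Re_cip[symmetric] cip_simps) simp
    ultimately show ?thesis by (simp add: complex_eq_iff Re_cip)
  qed
  with x(1) that show thesis by blast
qed

subsection \<open>Eigenvectors\<close>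

text \<open>The form of \<open>T\<close> at \<open>s *\<^sub>R x + y\<close> is a nonnegative
  quadratic polynomial in \<open>s\<close>. If its leading coefficient vanishes, it is affine and
  therefore constant.\<close>

lemma psd_cauchy_schwarz:
  fixes T :: "'a::real_inner \<Rightarrow> 'a"
  assumes "linear T" and S: "subspace S" and sa: "\<And>x y. x \<in> S \<Longrightarrow> y \<in> S \<Longrightarrow> x \<bullet> T y = T x \<bullet> y"
    and pos: "\<And>x. x \<in> S \<Longrightarrow> 0 \<le> x \<bullet> T x" and x: "x \<in> S" and y: "y \<in> S"
  shows "(x \<bullet> T y)\<^sup>2 \<le> (x \<bullet> T x) * (y \<bullet> T y)"
proof -
  interpret linear T by fact
  have q: "0 \<le> x \<bullet> T x * s\<^sup>2 + 2 * s * (x \<bullet> T y) + y \<bullet> T y" for s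
  proof -
    have "0 \<le> (s *\<^sub>R x + y) \<bullet> T (s *\<^sub>R x + y)"
      by (intro pos subspace_add[OF S] subspace_scale[OF S] x y)
    also have "\<dots> = x \<bullet> T x * s\<^sup>2 + 2 * s * (x \<bullet> T y) + y \<bullet> T y"
      using sa[OF y x] by (simp add: add scale inner_simps inner_commute power2_eq_square algebra_simps)
    finally show ?thesis .
  qed
  show ?thesis
  proof (cases "x \<bullet> T x = 0")
    case True
    have "x \<bullet> T y = 0"
    proof (rule ccontr)
      assume ne: "x \<bullet> T y \<noteq> 0"
      have "2 * (- (y \<bullet> T y + 1) / (2 * (x \<bullet> T y))) * (x \<bullet> T y) = - (y \<bullet> T y + 1)"
        using ne by (simp add: field_simps)
      then show False using q[of "- (y \<bullet> T y + 1) / (2 * (x \<bullet> T y))"] True by simp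
    qed
    then show ?thesis using True by simp
  next
    case False
    then have p: "0 < x \<bullet> T x" using pos[OF x] by simp
    have "0 \<le> (x \<bullet> T x) * (x \<bullet> T x * (- (x \<bullet> T y) / (x \<bullet> T x))\<^sup>2 + 2 * (- (x \<bullet> T y) / (x \<bullet> T x)) * (x \<bullet> T y) + y \<bullet> T y)"
      using q p by (metis less_imp_le mult_nonneg_nonneg)
    also have "\<dots> = (x \<bullet> T x) * (y \<bullet> T y) - (x \<bullet> T y)\<^sup>2"
      using p by (simp add: field_simps power2_eq_square)
    finally show ?thesis by simp
  qed
qed

text \<open>Let the form of \<open>T\<close> have its maximum \<open>l\<close> on the unit sphere of
  \<open>S\<close> at \<open>x\<close>. Then \<open>?U\<close> is positive semidefinite on
  \<open>S\<close> with vanishing form at \<open>x\<close>, and Cauchy-Schwarz for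
  \<open>?U x\<close> and \<open>x\<close> gives \<open>?U x = 0\<close>.\<close>

lemma selfadjoint_eigenvector:
  fixes T :: "'a::euclidean_space \<Rightarrow> 'a"
  assumes T: "linear T" and S: "subspace S" "S \<noteq> {0}" and inv: "\<And>x. x \<in> S \<Longrightarrow> T x \<in> S"
    and sa: "\<And>x y. x \<in> S \<Longrightarrow> y \<in> S \<Longrightarrow> x \<bullet> T y = T x \<bullet> y"
  obtains x l where "x \<in> S" "x \<noteq> 0" "T x = l *\<^sub>R x"
proof -
  interpret linear T by fact
  let ?K = "S \<inter> sphere 0 1"
  have "compact ?K" by (intro closed_Int_compact closed_subspace S compact_sphere)
  moreover obtain z where z: "z \<in> S" "z \<noteq> 0" using S subspace_0 by blast
  then have "z /\<^sub>R norm z \<in> ?K" using S(1) by (simp add: subspace_scale)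
  then have "?K \<noteq> {}" by blast
  moreover have "continuous_on ?K (\<lambda>x. x \<bullet> T x)"
    by (intro continuous_intros linear_continuous_on linear_conv_bounded_linear[THEN iffD1] T)
  ultimately obtain x where x: "x \<in> ?K" and max: "\<And>y. y \<in> ?K \<Longrightarrow> y \<bullet> T y \<le> x \<bullet> T x"
    using continuous_attains_sup by metis
  define l where "l = x \<bullet> T x"
  let ?U = "\<lambda>y. l *\<^sub>R y - T y"
  have U: "linear ?U" by (intro linear_compose_sub linear_scale_self T)
  have pos: "0 \<le> y \<bullet> ?U y" if "y \<in> S" for y
  proof (cases "y = 0")
    case False
    have "y /\<^sub>R norm y \<in> ?K" using that False S(1) by (simp add: subspace_scale)
    from max[OF this] have "(y \<bullet> T y) / (norm y)\<^sup>2 \<le> l"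
      by (simp add: scale l_def power2_eq_square divide_inverse mult_ac)
    then have "y \<bullet> T y \<le> l * (norm y)\<^sup>2" using False by (simp add: field_simps)
    then show ?thesis by (simp add: inner_diff_right power2_norm_eq_inner)
  qed simp
  have xx: "x \<in> S" "x \<bullet> x = 1" using x by (auto simp: norm_eq_1)
  have Ux: "?U x \<in> S" using xx inv S(1) by (simp add: subspace_diff subspace_scale)
  have "(?U x \<bullet> ?U x)\<^sup>2 \<le> (?U x \<bullet> ?U (?U x)) * (x \<bullet> ?U x)"
    by (rule psd_cauchy_schwarz[OF U S(1) _ pos Ux xx(1)]) (auto simp: inner_diff_left inner_diff_right sa)
  also have "x \<bullet> ?U x = 0" using xx by (simp add: inner_diff_right l_def)
  finally have "?U x = 0" by simp
  then have "T x = l *\<^sub>R x" by simp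
  moreover have "x \<noteq> 0" using xx(2) by auto
  ultimately show thesis using that xx(1) by blast
qed

text \<open>\<open>J\<close> is multiplication by the imaginary unit, so that \<open>N\<close> has the eigenvalue
  \<open>a - \<i> b\<close> and its adjoint \<open>N'\<close> the eigenvalue \<open>a + \<i> b\<close>.\<close>

lemma normal_eigenvector:
  fixes N N' J :: "'a::euclidean_space \<Rightarrow> 'a"
  assumes N: "linear N" and N': "linear N'" and J: "linear J" and S: "subspace S" "S \<noteq> {0}"
    and inv: "\<And>x. x \<in> S \<Longrightarrow> N x \<in> S" "\<And>x. x \<in> S \<Longrightarrow> N' x \<in> S" "\<And>x. x \<in> S \<Longrightarrow> J x \<in> S"
    and adj: "\<And>x y. x \<bullet> N y = N' x \<bullet> y"
    and normal: "\<And>x. x \<in> S \<Longrightarrow> N (N' x) = N' (N x)"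
    and JJ: "\<And>x. J (J x) = - x" and Jskew: "\<And>x y. J x \<bullet> y = - (x \<bullet> J y)"
    and JN: "\<And>x. J (N x) = N (J x)" and JN': "\<And>x. J (N' x) = N' (J x)"
  obtains x a b where "x \<in> S" "x \<noteq> 0" "N x = a *\<^sub>R x - b *\<^sub>R J x" "N' x = a *\<^sub>R x + b *\<^sub>R J x"
proof -
  interpret N: linear N by fact
  interpret N': linear N' by fact
  interpret J: linear J by fact
  have adj': "x \<bullet> N' y = N x \<bullet> y" for x y using adj[of y x] by (simp add: inner_commute)
  \<comment> \<open>Up to real factors, \<open>?H\<close> and \<open>?K\<close> are the real and
    imaginary parts of \<open>N\<close>. Both are self-adjoint and they commute by normality, so the
    eigenspace \<open>S'\<close> of \<open>?H\<close> contains an eigenvector of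
    \<open>?K\<close>.\<close>
  let ?H = "\<lambda>x. N x + N' x" and ?K = "\<lambda>x. J (N x - N' x)"
  have "linear ?H" by (intro linear_compose_add N N')
  moreover have "?H x \<in> S" if "x \<in> S" for x using that inv S(1) by (simp add: subspace_add)
  moreover have "x \<bullet> ?H y = ?H x \<bullet> y" for x y by (simp add: inner_add_left inner_add_right adj adj')
  ultimately obtain x l where x: "x \<in> S" "x \<noteq> 0" "?H x = l *\<^sub>R x"
    by (rule selfadjoint_eigenvector[OF _ S]) blast+
  define S' where "S' = {x \<in> S. ?H x = l *\<^sub>R x}"
  have S': "subspace S'" using S(1)
    by (auto simp: S'_def subspace_def N.add N'.add N.scale N'.scale scaleR_add_right[symmetric])
       (simp add: algebra_simps)
  have K: "linear ?K" by (intro linear_compose[unfolded o_def, OF _ J] linear_compose_sub N N')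
  have inv': "?K y \<in> S'" if "y \<in> S'" for y
  proof -
    have y: "y \<in> S" "?H y = l *\<^sub>R y" using that by (auto simp: S'_def)
    have "?H (?K y) = J (N (?H y) - N' (?H y))"
      using normal[OF y(1)] by (simp add: JN[symmetric] JN'[symmetric] J.add[symmetric] N.add N'.add N.diff N'.diff)
    then have "?H (?K y) = l *\<^sub>R ?K y" by (simp add: y N.scale N'.scale J.scale scaleR_diff_right[symmetric])
    then show ?thesis using y inv S(1) by (simp add: S'_def subspace_diff)
  qed
  have sa: "u \<bullet> ?K v = ?K u \<bullet> v" for u v
  proof -
    have "?K u \<bullet> v = - ((N u - N' u) \<bullet> J v)" by (simp add: Jskew)
    also have "\<dots> = u \<bullet> (N (J v) - N' (J v))" by (simp add: inner_diff_left inner_diff_right adj adj')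
    finally show ?thesis by (simp add: JN JN' J.diff)
  qed
  have "S' \<noteq> {0}" using x by (auto simp: S'_def)
  then obtain y m where y: "y \<in> S'" "y \<noteq> 0" "?K y = m *\<^sub>R y"
    using selfadjoint_eigenvector[OF K S' _ inv' sa] by metis
  have "J (?K y) = m *\<^sub>R J y" using y by (simp add: J.scale)
  then have d: "N y - N' y = - m *\<^sub>R J y" by (simp add: JJ) (metis minus_diff_eq)
  have s: "N y + N' y = l *\<^sub>R y" using y by (simp add: S'_def)
  have "N y = (1/2) *\<^sub>R ((N y + N' y) + (N y - N' y))" by (simp add: algebra_simps flip: scaleR_2)
  moreover have "N' y = (1/2) *\<^sub>R ((N y + N' y) - (N y - N' y))" by (simp add: algebra_simps flip: scaleR_2)
  ultimately show thesis
    using that[of y "l/2" "m/2"] y unfolding d s by (auto simp: S'_def algebra_simps)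
qed

subsection \<open>Spectral decomposition\<close>

lemma adj_mult_nth: "(adj M ** X) $ i $ j = cip (column i M) (column j X)"
  by (simp add: matrix_matrix_mult_def cip_def column_def)

lemma column_mult: "column j (A ** M) = A *v column j M"
  by (simp add: vec_eq_iff column_def matrix_matrix_mult_def matrix_vector_mult_def)

definition orthonormal_on :: "'i set \<Rightarrow> ('i \<Rightarrow> complex^'n) \<Rightarrow> bool" where
  "orthonormal_on J b \<longleftrightarrow> (\<forall>i\<in>J. \<forall>j\<in>J. cip (b i) (b j) = (if i = j then 1 else 0))"

lemma orthonormal_expansion:
  fixes b :: "'n \<Rightarrow> complex^'n"
  assumes "orthonormal_on UNIV b"
  shows "x = (\<Sum>i\<in>UNIV. cip (b i) x *s b i)"
proof -
  define U where "U = (\<chi> i j. b j $ i)"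
  have col: "column j U = b j" for j by (simp add: vec_eq_iff U_def column_def)
  have "adj U ** U = mat 1"
    using assms by (simp add: vec_eq_iff adj_mult_nth col orthonormal_on_def) (simp add: mat_def)
  then have "U ** adj U = mat 1" by (simp add: matrix_left_right_inverse)
  then have "x = U *v (adj U *v x)" by (simp add: matrix_vector_mul_assoc)
  also have "\<dots> = (\<Sum>i\<in>UNIV. cip (b i) x *s b i)"
    by (simp add: vec_eq_iff matrix_vector_mult_def U_def cip_def mult.commute)
  finally show ?thesis .
qed

theorem hermitian_eigenbasis:
  fixes A :: "complex^'n^'n"
  assumes "hermitian A"
  obtains b :: "'n \<Rightarrow> complex^'n" and l where "orthonormal_on UNIV b" "\<And>i. A *v b i = complex_of_real (l i) *s b i"
proof -
  have adjA: "adj A = A" using assms by (simp add: hermitian_iff_adj)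
  have "\<exists>b l. orthonormal_on J b \<and> (\<forall>i\<in>J. A *v b i = complex_of_real (l i) *s b i)"
    if "finite J" for J :: "'n set"
    using that
  proof (induction J rule: finite_induct)
    case empty
    show ?case by (simp add: orthonormal_on_def)
  next
    case (insert k J)
    then obtain b l where o: "orthonormal_on J b"
      and ev: "\<And>i. i \<in> J \<Longrightarrow> A *v b i = complex_of_real (l i) *s b i"
      by blast
    \<comment> \<open>The complement of the eigenvectors found so far is invariant because
      \<open>A\<close> is self-adjoint, and nonzero because \<open>J\<close> misses
      \<open>k\<close>.\<close>
    define S where "S = {x. \<forall>i\<in>J. cip (b i) x = 0}"
    have S: "subspace S" by (auto simp: S_def subspace_def scaleR_eq_scale cip_simps)
    have "card (b ` J) \<le> card J" using insert by (simp add: card_image_le)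
    also have "\<dots> < CARD('n)" using insert(2) by (intro psubset_card_mono) auto
    finally obtain x where "x \<noteq> 0" "\<And>i. i \<in> J \<Longrightarrow> cip (b i) x = 0"
      using complex_orthogonal_exists[of "b ` J"] insert(1) by (metis finite_imageI imageI)
    then have S0: "S \<noteq> {0}" by (auto simp: S_def)
    have "A *v x \<in> S" if "x \<in> S" for x
      using that ev by (auto simp: S_def cip_adj adjA cip_simps)
    moreover have "x \<bullet> (A *v y) = (A *v x) \<bullet> y" for x y by (simp add: inner_adj adjA)
    ultimately obtain x m where x: "x \<in> S" "x \<noteq> 0" "A *v x = m *\<^sub>R x"
      using selfadjoint_eigenvector[OF linear_matrix_vec S S0] by metis
    define y where "y = complex_of_real (1 / norm x) *s x"
    have "cip y y = 1" using x
      by (simp only: y_def cip_scale_left cip_scale_right) (simp add: cip_self power2_eq_square)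
    moreover have "cip (b i) y = 0" if "i \<in> J" for i using x that by (simp add: y_def S_def cip_simps)
    moreover from this have "cip y (b i) = 0" if "i \<in> J" for i using that cip_commute[of y "b i"] by simp
    moreover have "A *v y = complex_of_real m *s y"
      using x by (simp add: y_def vector_scalar_commute scaleR_eq_scale vector_smult_assoc mult.commute)
    ultimately have "orthonormal_on (insert k J) (b(k := y)) \<and>
        (\<forall>i\<in>insert k J. A *v (b(k := y)) i = complex_of_real ((l(k := m)) i) *s (b(k := y)) i)"
      using o ev insert(2) by (auto simp: orthonormal_on_def)
    then show ?case by blast
  qed
  from this[of UNIV] obtain b :: "'n \<Rightarrow> complex^'n" and l
    where "orthonormal_on UNIV b" "\<And>i. A *v b i = complex_of_real (l i) *s b i"
    by auto
  then show thesis by (rule that)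
qed

text \<open>The columns of \<open>M\<close> are eigenvectors divided by the square roots of their
  eigenvalues. Those in the kernel keep length 1, so that \<open>M\<close> stays invertible.\<close>

lemma psd_congruence_projection:
  fixes A :: "complex^'n^'n"
  assumes "hermitian A" and pos: "\<And>u. 0 \<le> u \<bullet> (A *v u)"
  obtains M N :: "complex^'n^'n" where "M ** N = mat 1" "N ** M = mat 1" "adj (adj M ** A ** M) = adj M ** A ** M"
    "(adj M ** A ** M) ** (adj M ** A ** M) = adj M ** A ** M"
proof -
  obtain b :: "'n \<Rightarrow> complex^'n" and l
    where b: "orthonormal_on UNIV b" and ev: "\<And>i. A *v b i = complex_of_real (l i) *s b i"
    using hermitian_eigenbasis[OF assms(1)] by metis
  have l: "0 \<le> l i" for i
    using pos[of "b i"] b unfolding Re_cip[symmetric] by (simp add: ev cip_simps orthonormal_on_def)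
  define s where "s i = (if l i = 0 then 1 else 1 / sqrt (l i))" for i
  have s: "s i \<noteq> 0" "s i * s i * l i = (if l i = 0 then 0 else 1)" for i
    using l[of i] by (simp_all add: s_def field_simps)
  define M where "M = (\<chi> i j. complex_of_real (s j) * b j $ i)"
  define N where "N = (\<chi> i j. cnj (b i $ j) / complex_of_real (s i))"
  have col: "column j M = complex_of_real (s j) *s b j" for j by (simp add: vec_eq_iff M_def column_def)
  have "(N ** M) $ i $ j = complex_of_real (s j / s i) * cip (b i) (b j)" for i j
    by (simp add: N_def M_def matrix_matrix_mult_def cip_def sum_distrib_left field_simps)
  then have "(N ** M) $ i $ j = mat 1 $ i $ j" for i j
    using b s(1) by (simp add: orthonormal_on_def mat_def)
  then have NM: "N ** M = mat 1" by (simp add: vec_eq_iff)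
  have P: "(adj M ** A ** M) $ i $ j = (if i = j then if l i = 0 then 0 else 1 else 0)" for i j
  proof -
    have "(adj M ** A ** M) $ i $ j = complex_of_real (s i * s j * l j) * cip (b i) (b j)"
      unfolding matrix_mul_assoc[symmetric] adj_mult_nth column_mult col
      by (simp add: vector_scalar_commute cip_simps ev)
    moreover have "complex_of_real (s i * s i * l i) = (if l i = 0 then 0 else 1)" by (simp only: s(2)) simp
    ultimately show ?thesis using b by (cases "i = j") (simp_all add: orthonormal_on_def)
  qed
  show thesis
  proof (rule that[OF _ NM])
    show "M ** N = mat 1" using NM by (simp add: matrix_left_right_inverse)
    show "adj (adj M ** A ** M) = adj M ** A ** M" by (simp add: vec_eq_iff P)
    show "(adj M ** A ** M) ** (adj M ** A ** M) = adj M ** A ** M"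
      unfolding vec_eq_iff matrix_matrix_mult_def[of "adj M ** A ** M" "adj M ** A ** M"]
      by (simp add: P if_distrib[of "\<lambda>x. x * _"] cong: if_cong)
  qed
qed

text \<open>In dimension three, rank at least two means that the range contains a plane, which is
  given by its normal \<open>h\<close>. Ranks two and three need no separate treatment
  later.\<close>

lemma psd_rank_cases:
  fixes D :: "complex^3^3"
  assumes "hermitian D" and pos: "\<And>u. 0 \<le> u \<bullet> (D *v u)"
  obtains "D = 0" | d where "d \<noteq> 0" "D = outer d d"
    | h where "h \<noteq> 0" "\<And>x. cip h x = 0 \<Longrightarrow> \<exists>u. D *v u = x"
proof -
  obtain b :: "3 \<Rightarrow> complex^3" and l
    where b: "orthonormal_on UNIV b" and ev: "\<And>i. D *v b i = complex_of_real (l i) *s b i"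
    using hermitian_eigenbasis[OF assms(1)] by metis
  have l: "0 \<le> l i" for i
    using pos[of "b i"] b unfolding Re_cip[symmetric] by (simp add: ev cip_simps orthonormal_on_def)
  have D: "D *v x = (\<Sum>i\<in>UNIV. (complex_of_real (l i) * cip (b i) x) *s b i)" for x
    by (subst orthonormal_expansion[OF b, of x])
       (simp add: linear_sum[OF linear_matrix_vec] vector_scalar_commute ev vector_smult_assoc mult.commute)
  consider "\<forall>i. l i = 0" | i where "l i \<noteq> 0" "\<forall>j. j \<noteq> i \<longrightarrow> l j = 0" | i j where "i \<noteq> j" "l i \<noteq> 0" "l j \<noteq> 0"
    by metis
  then show thesis
  proof cases
    case 1
    then have "D = 0" by (intro matrix_eqI) (simp add: D)
    then show thesis by (rule that(1))
  next
    case 2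
    define d where "d = complex_of_real (sqrt (l i)) *s b i"
    have "D *v x = outer d d *v x" for x
    proof -
      have "D *v x = (\<Sum>j\<in>UNIV. if j = i then (complex_of_real (l i) * cip (b i) x) *s b i else 0)"
        unfolding D using 2 by (intro sum.cong) auto
      also have "\<dots> = outer d d *v x"
        using l[of i] by (simp add: outer_vec d_def cip_simps vector_smult_assoc mult_ac of_real_mult[symmetric]
            del: of_real_mult)
      finally show ?thesis .
    qed
    then have "D = outer d d" by (rule matrix_eqI)
    moreover have "cip d d = complex_of_real (l i)"
      using b l[of i] by (simp add: d_def cip_simps orthonormal_on_def of_real_mult[symmetric] del: of_real_mult)
    then have "d \<noteq> 0" using 2 by auto
    ultimately show thesis by (rule that(2)[rotated])
  next
    case 3
    have "card (UNIV - {i, j}) = 1" using 3 by (simp add: card_Diff_subset)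
    then obtain k where k: "UNIV - {i, j} = {k}" by (auto simp: card_1_singleton_iff)
    have "cip (b k) (b k) = 1" using b by (simp add: orthonormal_on_def)
    then have "b k \<noteq> 0" by auto
    moreover have "\<exists>u. D *v u = x" if "cip (b k) x = 0" for x
    proof
      have eq: "cip (b m) (\<Sum>n\<in>UNIV. (cip (b n) x / complex_of_real (l n)) *s b n) = cip (b m) x / complex_of_real (l m)" for m
      proof -
        have "cip (b m) (\<Sum>n\<in>UNIV. c n *s b n) = (\<Sum>n\<in>UNIV. c n * cip (b m) (b n))" for c
          unfolding cip_def by (simp add: sum_distrib_left sum_component mult_ac) (rule sum.swap)
        also have "(\<Sum>n\<in>UNIV. c n * cip (b m) (b n)) = (\<Sum>n\<in>UNIV. if n = m then c n else 0)" for c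
          using b by (intro sum.cong) (auto simp: orthonormal_on_def)
        finally show ?thesis by simp
      qed
      \<comment> \<open>Division by zero yields \<open>0\<close>. This is harmless, because an index
        with eigenvalue \<open>0\<close> can only be \<open>k\<close>, where the coefficient
        vanishes.\<close>
      have "l m = 0 \<Longrightarrow> cip (b m) x = 0" for m using 3 k that by (cases "m = k") auto
      then have "D *v (\<Sum>n\<in>UNIV. (cip (b n) x / complex_of_real (l n)) *s b n)
          = (\<Sum>i\<in>UNIV. cip (b i) x *s b i)"
        unfolding D eq by (intro sum.cong refl) auto
      then show "D *v (\<Sum>n\<in>UNIV. (cip (b n) x / complex_of_real (l n)) *s b n) = x"
        using orthonormal_expansion[OF b, of x] by simp
    qed
    ultimately show thesis by (rule that(3))
  qed
qed

subsection \<open>Bipartite matrices with a two-dimensional first factor\<close>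

text \<open>The triple \<open>(A, B, C)\<close> stands for the block matrix with rows \<open>(A, B)\<close> and
  \<open>(adj B, C)\<close>; \<open>pt\<close> is the partial transpose of the two-dimensional factor.\<close>

type_synonym 'n triple = "(complex^'n^'n) \<times> (complex^'n^'n) \<times> (complex^'n^'n)"

definition bop :: "('n::finite) triple \<Rightarrow> (complex^'n) \<times> (complex^'n) \<Rightarrow> (complex^'n) \<times> (complex^'n)" where
  "bop = (\<lambda>(A, B, C) (u, v). (A *v u + B *v v, adj B *v u + C *v v))"

definition pt :: "('n::finite) triple \<Rightarrow> 'n triple" where
  "pt = (\<lambda>(A, B, C). (A, adj B, C))"

definition block_psd :: "('n::finite) triple \<Rightarrow> bool" where
  "block_psd t \<longleftrightarrow> hermitian (fst t) \<and> hermitian (snd (snd t)) \<and> (\<forall>x. 0 \<le> x \<bullet> bop t x)"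

definition ppt :: "('n::finite) triple \<Rightarrow> bool" where
  "ppt t \<longleftrightarrow> block_psd t \<and> block_psd (pt t)"

text \<open>The rank-one matrix of the vector \<open>(p, q)\<close>. It belongs to a product vector
  with first factor \<open>(a, b)\<close> when \<open>p = a *s f\<close> and
  \<open>q = b *s f\<close>.\<close>

definition rk1 :: "complex^('n::finite) \<Rightarrow> complex^'n \<Rightarrow> 'n triple" where
  "rk1 p q = (outer p p, outer p q, outer q q)"

text \<open>A congruence on the second factor alone: it maps product vectors to product vectors and
  commutes with \<open>pt\<close>.\<close>

definition tcong :: "complex^('n::finite)^'n \<Rightarrow> ('n::finite) triple \<Rightarrow> 'n triple" where
  "tcong M = (\<lambda>(A, B, C). (adj M ** A ** M, adj M ** B ** M, adj M ** C ** M))"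

lemma pt_simps [simp]: "pt (A, B, C) = (A, adj B, C)" by (simp add: pt_def)

lemma bop_simps [simp]: "bop (A, B, C) (u, v) = (A *v u + B *v v, adj B *v u + C *v v)"
  by (simp add: bop_def)

lemma pt_pt [simp]: "pt (pt t) = t" by (cases t) simp

lemma ppt_pt: "ppt (pt t) \<longleftrightarrow> ppt t" by (auto simp: ppt_def)

lemma pt_diff: "pt (s - t) = pt s - pt t" by (cases s; cases t) (simp add: adj_diff)

lemma pt_scaleR: "pt (r *\<^sub>R t) = r *\<^sub>R pt t" by (cases t) (simp add: adj_scaleR)

text \<open>On a product vector partial transposition merely conjugates the first factor, so one
  subtraction can serve both \<open>t\<close> and \<open>pt t\<close>.\<close>

lemma pt_rk1: "pt (rk1 (a *s f) (b *s f)) = rk1 (cnj a *s f) (cnj b *s f)"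
  by (simp add: rk1_def vec_eq_iff mult_ac)

lemma bop_add: "bop (s + t) x = bop s x + bop t x"
  and bop_diff: "bop (s - t) x = bop s x - bop t x"
  and bop_scaleR: "bop (r *\<^sub>R t) x = r *\<^sub>R bop t x"
  by (cases s; cases t; cases x;
      simp add: adj_add adj_diff adj_scaleR matrix_vector_mult_add_rdistrib matrix_vector_mult_diff_rdistrib
        scaleR_matrix_vec scaleR_add_right)+

lemma linear_bop: "linear (bop t)"
  by (rule linearI; cases t)
     (auto simp: bop_def matrix_vector_right_distrib matrix_vec_scaleR scaleR_add_right)

lemma bop_selfadjoint:
  assumes "hermitian (fst t)" "hermitian (snd (snd t))"
  shows "x \<bullet> bop t y = bop t x \<bullet> y"
  using assms
  by (cases t; cases x; cases y)
     (simp add: hermitian_iff_adj inner_add_left inner_add_right inner_adj)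

lemma bop_ii: "bop t (\<i> *s u, \<i> *s v) = (\<i> *s fst (bop t (u, v)), \<i> *s snd (bop t (u, v)))"
  by (cases t) (simp add: vector_scalar_commute vector_add_ldistrib)

lemma block_psd_cauchy_schwarz:
  assumes "block_psd t"
  shows "(x \<bullet> bop t y)\<^sup>2 \<le> (x \<bullet> bop t x) * (y \<bullet> bop t y)"
  using psd_cauchy_schwarz[OF linear_bop subspace_UNIV] bop_selfadjoint assms
  unfolding block_psd_def by (metis UNIV_I)

lemma block_psd_null:
  assumes "block_psd t" "x \<bullet> bop t x = 0"
  shows "bop t x = 0"
proof -
  have "(bop t x \<bullet> bop t x)\<^sup>2 \<le> 0"
    using block_psd_cauchy_schwarz[OF assms(1), of "bop t x" x] assms(2) by simp
  then show ?thesis by simp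
qed

text \<open>The form is the squared modulus of the complex inner product with \<open>(p, q)\<close>.
  Its real and imaginary parts are separated so that the real Cauchy-Schwarz inequality applies to
  each.\<close>

lemma rk1_form:
  fixes p q :: "complex^'n"
  shows "x \<bullet> bop (rk1 p q) x = (x \<bullet> (p, q))\<^sup>2 + (x \<bullet> (\<i> *s p, \<i> *s q))\<^sup>2"
proof (cases x)
  case (Pair u v)
  define c where "c = cip p u + cip q v"
  have 1: "u \<bullet> p + v \<bullet> q = Re c" by (simp add: c_def Re_cip inner_commute)
  have 2: "u \<bullet> (\<i> *s p) + v \<bullet> (\<i> *s q) = Im c"
    by (simp only: c_def Re_cip[symmetric] cip_simps) (simp add: cip_commute[of u p] cip_commute[of v q])
  have "cip p u *s w + cip q v *s w = c *s w" for w :: "complex^'n"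
    by (simp add: c_def vec_eq_iff algebra_simps)
  then have "x \<bullet> bop (rk1 p q) x = Re (cip u (c *s p) + cip v (c *s q))"
    by (simp add: Pair rk1_def outer_vec Re_cip)
  also have "cip u (c *s p) + cip v (c *s q) = c * cnj c"
    by (simp add: cip_simps c_def cip_commute[of u p] cip_commute[of v q] algebra_simps)
  finally show ?thesis by (simp add: Pair 1 2 power2_eq_square)
qed

lemma inner_ii: "(\<i> *s u) \<bullet> (\<i> *s v) = u \<bullet> (v :: complex^'n)"
  by (simp only: Re_cip[symmetric] cip_simps) simp

lemma hermitian_outer: "hermitian (outer p p)"
  by (simp add: hermitian_iff_adj)

text \<open>Vectors in the range of \<open>t\<close> can be subtracted with a small weight:
  Cauchy-Schwarz at \<open>x\<close> and at \<open>\<i>\<close> times \<open>x\<close> bounds the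
  two squares in \<open>rk1_form\<close>, whence the factor 2.\<close>

lemma block_psd_diff_rk1:
  assumes t: "block_psd t" and x: "bop t x = (p, q)" and e: "0 \<le> e" "2 * e * (x \<bullet> bop t x) \<le> 1"
  shows "block_psd (t - e *\<^sub>R rk1 p q)"
  unfolding block_psd_def
proof (intro conjI allI)
  show "hermitian (fst (t - e *\<^sub>R rk1 p q))" "hermitian (snd (snd (t - e *\<^sub>R rk1 p q)))"
    using t by (cases t, simp add: block_psd_def rk1_def hermitian_iff_adj adj_diff adj_scaleR)+
  fix y
  let ?ix = "(\<i> *s fst x, \<i> *s snd x)"
  have ix: "bop t ?ix = (\<i> *s p, \<i> *s q)" using bop_ii[of t "fst x" "snd x"] x by simp
  have "?ix \<bullet> bop t ?ix = x \<bullet> bop t x"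
    unfolding ix x by (cases x) (simp add: inner_ii)
  then have "(y \<bullet> (\<i> *s p, \<i> *s q))\<^sup>2 \<le> (y \<bullet> bop t y) * (x \<bullet> bop t x)"
    using block_psd_cauchy_schwarz[OF t, of y ?ix] by (simp add: ix)
  moreover have "(y \<bullet> (p, q))\<^sup>2 \<le> (y \<bullet> bop t y) * (x \<bullet> bop t x)"
    using block_psd_cauchy_schwarz[OF t, of y x] by (simp add: x)
  ultimately have "y \<bullet> bop (rk1 p q) y \<le> 2 * ((y \<bullet> bop t y) * (x \<bullet> bop t x))"
    by (simp add: rk1_form)
  from mult_left_mono[OF this e(1)] have "e * (y \<bullet> bop (rk1 p q) y) \<le> (2 * e * (x \<bullet> bop t x)) * (y \<bullet> bop t y)"
    by (simp add: mult_ac)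
  also have "\<dots> \<le> 1 * (y \<bullet> bop t y)"
    using t e(2) unfolding block_psd_def by (intro mult_right_mono) blast+
  finally show "0 \<le> y \<bullet> bop (t - e *\<^sub>R rk1 p q) y"
    by (simp add: bop_diff bop_scaleR inner_diff_right)
qed

section \<open>Subtracting product vectors from PPT matrices\<close>

definition product_subtractable :: "('n::finite) triple \<Rightarrow> bool" where
  "product_subtractable t \<longleftrightarrow> (\<exists>a b f e. f \<noteq> 0 \<and> (a \<noteq> 0 \<or> b \<noteq> 0) \<and> 0 < e \<and>
     ppt (t - e *\<^sub>R rk1 (a *s f) (b *s f)))"

text \<open>Range criterion: the product vector lies in the range of \<open>t\<close> and its
  partial conjugate in the range of \<open>pt t\<close>. The weight \<open>e\<close> is small enough
  for both.\<close>

lemma product_subtractableI: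
  assumes t: "ppt t" and f: "f \<noteq> 0" "a \<noteq> 0 \<or> b \<noteq> 0"
    and x: "bop t x = (a *s f, b *s f)" and y: "bop (pt t) y = (cnj a *s f, cnj b *s f)"
  shows "product_subtractable t"
proof -
  define e where "e = 1 / (1 + 2 * (x \<bullet> bop t x) + 2 * (y \<bullet> bop (pt t) y))"
  have nn: "0 \<le> x \<bullet> bop t x" "0 \<le> y \<bullet> bop (pt t) y" using t unfolding ppt_def block_psd_def by blast+
  then have e: "0 < e" "2 * e * (x \<bullet> bop t x) \<le> 1" "2 * e * (y \<bullet> bop (pt t) y) \<le> 1"
    by (simp_all add: e_def field_simps)
  have "block_psd (t - e *\<^sub>R rk1 (a *s f) (b *s f))"
    using t e x by (intro block_psd_diff_rk1) (auto simp: ppt_def)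
  moreover have "block_psd (pt t - e *\<^sub>R rk1 (cnj a *s f) (cnj b *s f))"
    using t e y by (intro block_psd_diff_rk1) (auto simp: ppt_def)
  ultimately have "ppt (t - e *\<^sub>R rk1 (a *s f) (b *s f))"
    by (simp add: ppt_def pt_diff pt_scaleR pt_rk1)
  then show ?thesis using f e(1) unfolding product_subtractable_def by blast
qed

lemma product_subtractable_pt:
  assumes "product_subtractable (pt t)" shows "product_subtractable t"
proof -
  obtain a b f e where *: "f \<noteq> 0" "a \<noteq> 0 \<or> b \<noteq> 0" "0 < e" "ppt (pt t - e *\<^sub>R rk1 (a *s f) (b *s f))"
    using assms by (auto simp: product_subtractable_def)
  then have "ppt (t - e *\<^sub>R rk1 (cnj a *s f) (cnj b *s f))"
    using ppt_pt[of "pt t - e *\<^sub>R rk1 (a *s f) (b *s f)"] by (simp add: pt_diff pt_scaleR pt_rk1)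
  with * show ?thesis unfolding product_subtractable_def by (metis complex_cnj_zero_iff)
qed

lemma inner_tcong: "(u, v) \<bullet> bop (tcong M t) (u, v) = (M *v u, M *v v) \<bullet> bop t (M *v u, M *v v)"
  by (cases t)
     (simp add: tcong_def adj_mult matrix_vector_mul_assoc[symmetric] inner_add_right inner_adj)

lemma pt_tcong: "pt (tcong M t) = tcong M (pt t)"
  by (cases t) (simp add: tcong_def adj_mult matrix_mul_assoc)

lemma block_psd_tcong: "block_psd t \<Longrightarrow> block_psd (tcong M t)"
  unfolding block_psd_def
  by (cases t) (auto simp del: bop_simps simp: inner_tcong, auto simp: tcong_def hermitian_iff_adj adj_mult matrix_mul_assoc)

lemma ppt_tcong: "ppt t \<Longrightarrow> ppt (tcong M t)"
  by (simp add: ppt_def pt_tcong block_psd_tcong)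

lemma matrix_mul_scaleR: "A ** (r *\<^sub>R B) = r *\<^sub>R (A ** B)" "(r *\<^sub>R A) ** B = r *\<^sub>R (A ** B)"
  for A B :: "complex^'n^'n"
  by (simp_all add: vec_eq_iff matrix_matrix_mult_def scaleR_right.sum)

lemma matrix_mul_diff: "A ** (B - C) = A ** B - A ** C" "(B - C) ** A = B ** A - C ** A"
  for A B C :: "complex^'n^'n"
  by (simp_all add: vec_eq_iff matrix_matrix_mult_def algebra_simps sum_subtractf)

lemma tcong_diff: "tcong M (s - t) = tcong M s - tcong M t"
  by (cases s; cases t) (simp add: tcong_def matrix_mul_diff)

lemma tcong_scaleR: "tcong M (r *\<^sub>R t) = r *\<^sub>R tcong M t"
  by (cases t) (simp add: tcong_def matrix_mul_scaleR)

lemma tcong_rk1: "tcong M (rk1 p q) = rk1 (adj M *v p) (adj M *v q)"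
  by (simp add: tcong_def rk1_def outer_mult_left outer_mult_right)

lemma tcong_inverse:
  assumes "M ** N = mat 1" shows "tcong N (tcong M t) = t"
proof -
  have 1: "adj N ** adj M = mat 1" using assms by (metis adj_mult adj_mat1)
  have "adj N ** (adj M ** A ** M) ** N = A" for A
  proof -
    have "adj N ** (adj M ** A ** M) ** N = (adj N ** adj M) ** A ** (M ** N)"
      by (simp only: matrix_mul_assoc)
    then show ?thesis by (simp add: 1 assms)
  qed
  then show ?thesis by (cases t) (simp add: tcong_def)
qed

text \<open>A subtraction found after the congruence is pulled back with the inverse
  \<open>N\<close>; the second factor \<open>f\<close> becomes \<open>adj N *v f\<close>.\<close>

lemma product_subtractable_tcong:
  assumes MN: "M ** N = mat 1" "N ** M = mat 1" and "product_subtractable (tcong M t)"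
  shows "product_subtractable t"
proof -
  obtain a b f e where *: "f \<noteq> 0" "a \<noteq> 0 \<or> b \<noteq> 0" "0 < e" "ppt (tcong M t - e *\<^sub>R rk1 (a *s f) (b *s f))"
    using assms(3) by (auto simp: product_subtractable_def)
  have "ppt (t - e *\<^sub>R rk1 (a *s (adj N *v f)) (b *s (adj N *v f)))"
    using ppt_tcong[OF *(4), of N]
    by (simp add: tcong_diff tcong_inverse[OF MN(1)] tcong_scaleR tcong_rk1 vector_scalar_commute)
  moreover have "adj N *v f \<noteq> 0"
  proof
    assume "adj N *v f = 0"
    then have "(adj M ** adj N) *v f = 0" by (simp add: matrix_vector_mul_assoc[symmetric])
    then show False using *(1) MN(2) by (metis adj_mat1 adj_mult matrix_vector_mul_lid)
  qed
  ultimately show ?thesis using * unfolding product_subtractable_def by blast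
qed

subsection \<open>Defects of rank one\<close>

lemma orthogonal_triple_complete:
  fixes a b c x :: "complex^3"
  assumes ne: "a \<noteq> 0" "b \<noteq> 0" "c \<noteq> 0" and ortho: "cip a b = 0" "cip a c = 0" "cip b c = 0"
    and x: "cip a x = 0" "cip b x = 0" "cip c x = 0"
  shows "x = 0"
proof -
  define n where "n v = complex_of_real (1 / norm v) *s v" for v :: "complex^3"
  define e where "e = (\<lambda>i::3. if i = 1 then n a else if i = 2 then n b else n c)"
  have n1: "cip (n v) (n v) = 1" if "v \<noteq> 0" for v
    using that by (simp only: n_def cip_scale_left cip_scale_right) (simp add: cip_self power2_eq_square)
  have n0: "cip (n v) (n w) = 0" if "cip v w = 0" for v w
    using that by (simp add: n_def cip_simps)
  have ortho': "cip b a = 0" "cip c a = 0" "cip c b = 0" using ortho by (metis cip_commute complex_cnj_zero)+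
  have "orthonormal_on UNIV e"
    using ne ortho ortho' by (simp add: orthonormal_on_def forall_3 e_def n1 n0)
  moreover have "cip (e i) x = 0" for i using x by (simp add: e_def n_def cip_simps)
  ultimately show ?thesis using orthonormal_expansion[of e x] by simp
qed

lemma matrix_mul_add: "(B + C) ** A = B ** A + C ** A" for A B C :: "complex^'n^'n"
  by (simp add: vec_eq_iff matrix_matrix_mult_def algebra_simps sum.distrib)

lemma trace_outer_left: "trace (outer u v ** X) = cip v (X *v u)"
  by (simp add: trace_cyclic[of "outer u v"] trace_outer)

text \<open>For a suitable phase \<open>\<phi>\<close> and scalar \<open>z\<close>, bordering
  \<open>B\<close> by the column \<open>\<phi> *s g\<close>, the conjugate of \<open>d\<close> as a
  row and the corner \<open>z\<close> gives a normal matrix. The first components of its eigenvalue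
  equation and of that of its adjoint are the equations for \<open>f\<close>.\<close>

lemma rank_one_defect_eigenvector:
  fixes B P :: "complex^3^3" and d g :: "complex^3"
  assumes eq: "adj B ** B + outer d d = B ** adj B + outer g g"
    and PB: "P ** B = B" "P ** adj B = adj B" and Pd: "P *v d = d" and Pg: "P *v g = g"
    and indep: "\<And>c. g \<noteq> c *s d" and d: "d \<noteq> 0"
  obtains f \<beta> s s' where "f \<noteq> 0" "P *v f = f" "\<beta> *s f - adj B *v f = s *s d" "cnj \<beta> *s f - B *v f = s' *s g"
proof -
  let ?X = "adj B ** B" and ?Y = "B ** adj B"
  define m where "m = cip d d"
  define p where "p = cip d g"
  define x where "x = B *v d"
  define y where "y = adj B *v g"
  have m0: "m \<noteq> 0" using d by (simp add: m_def cip_self)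
  have g0: "g \<noteq> 0" using indep[of 0] by simp
  \<comment> \<open>The traces of \<open>eq\<close>, of \<open>B\<close> times \<open>eq\<close> and
    of its square show in turn that \<open>d\<close> and \<open>g\<close> have equal norm, that the
    form of \<open>B\<close> agrees at both, and that \<open>x\<close> and \<open>y\<close> have
    equal norm.\<close>
  have "trace (?X + outer d d) = trace (?Y + outer g g)" using eq by simp
  then have mg: "cip g g = m" using trace_cyclic[of B "adj B"] by (simp add: trace_add trace_outer_only m_def)
  have "trace (B ** (?X + outer d d)) = trace (B ** (?Y + outer g g))" using eq by simp
  moreover have "trace (B ** ?X) = trace (B ** ?Y)" using trace_cyclic[of B ?Y] by (simp add: matrix_mul_assoc)
  ultimately have gg: "cip g (B *v g) = cip d x"
    by (simp add: matrix_add_ldistrib trace_add trace_outer x_def)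
  have "trace ((?X + outer d d) ** (?X + outer d d)) = trace ((?Y + outer g g) ** (?Y + outer g g))"
    using eq by simp
  moreover have "trace (?X ** ?X) = trace (?Y ** ?Y)"
    using trace_cyclic[of "adj B" "B ** adj B ** B"] by (simp add: matrix_mul_assoc)
  ultimately have "2 * cip d (?X *v d) + m * m = 2 * cip g (?Y *v g) + m * m"
    by (simp add: matrix_add_ldistrib matrix_mul_add trace_add trace_outer trace_outer_left
        outer_vec cip_simps mg m_def[symmetric])
  then have "cip d (?X *v d) = cip g (?Y *v g)" by simp
  then have norms: "cip x x = cip y y"
    by (simp add: x_def y_def cip_adj matrix_vector_mul_assoc[symmetric])

  \<comment> \<open>\<open>e\<close> is the part of \<open>g\<close> orthogonal to \<open>d\<close>.
    It serves to choose \<open>a\<close> and \<open>b\<close> such that the rest \<open>x0\<close>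
    of \<open>x\<close> is orthogonal to \<open>d\<close> and \<open>g\<close>.\<close>
  define e where "e = g - (p / m) *s d"
  have e: "e \<noteq> 0" "cip d e = 0" using indep[of "p / m"] m0 by (auto simp: e_def cip_simps p_def m_def)
  define b where "b = cip e x / cip e e"
  define a where "a = (cip d x - b * p) / m"
  define x0 where "x0 = x - a *s d - b *s g"
  have "cip e e \<noteq> 0" using e by (simp add: cip_self)
  have dx0: "cip d x0 = 0" using m0 by (simp add: x0_def a_def cip_simps p_def m_def)
  have "x0 = x - ((cip d x) / m) *s d - b *s e"
    using m0 by (simp add: x0_def a_def e_def vec_eq_iff field_simps)
  then have ex0: "cip e x0 = 0"
    using \<open>cip e e \<noteq> 0\<close> e(2) cip_commute[of e d] by (simp add: cip_simps b_def)
  have gx0: "cip g x0 = 0"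
  proof -
    have "g = e + (p / m) *s d" by (simp add: e_def)
    then show ?thesis using ex0 dx0 by (simp only: cip_simps) simp
  qed
  have dg: "cip g d = cnj p" by (simp add: p_def cip_commute[of g d])
  have cm: "cnj m = m" by (simp add: m_def cip_self)
  have s1: "cip d x = a * m + b * p" and s2: "cip g x = a * cnj p + b * m"
    using dx0 gx0 by (simp_all add: x0_def cip_simps m_def[symmetric] p_def[symmetric] dg mg diff_eq_eq add.commute)
  \<comment> \<open>Since \<open>cip g y\<close> and \<open>cip d y\<close> are conjugate to
    \<open>cip d x\<close> and \<open>cip g x\<close>, the coefficients of \<open>x\<close> reappear
    conjugated and with \<open>d\<close> and \<open>g\<close> exchanged.\<close>
  define y0 where "y0 = y - cnj a *s g - cnj b *s d"
  have "cip g y = cnj (cip d x)" unfolding gg[symmetric] y_def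
    by (metis adj_adj cip_adj cip_commute)
  then have gy0: "cip g y0 = 0" by (simp add: y0_def cip_simps mg dg s1 cm)
  have "cip d y = cnj (cip g x)" unfolding y_def x_def
    by (metis adj_adj cip_adj cip_commute)
  then have dy0: "cip d y0 = 0" by (simp add: y0_def cip_simps m_def[symmetric] p_def[symmetric] s2 cm)
  have x0s: "cip x0 d = 0" "cip x0 g = 0" "cip y0 d = 0" "cip y0 g = 0"
    using dx0 gx0 gy0 dy0 by (metis cip_commute complex_cnj_zero)+
  have xe: "x = x0 + a *s d + b *s g" and ye: "y = y0 + cnj a *s g + cnj b *s d"
    by (simp_all add: x0_def y0_def)
  have n0: "cip x0 x0 = cip y0 y0"
    using norms unfolding xe ye
    by (simp add: cip_simps x0s dx0 gx0 gy0 dy0 m_def[symmetric] p_def[symmetric] dg mg)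
       (simp add: algebra_simps)
  \<comment> \<open>\<open>x0\<close> and \<open>y0\<close> lie on the complex line orthogonal to
    \<open>d\<close> and \<open>g\<close> and have equal norm.\<close>
  obtain \<phi> where \<phi>: "cmod \<phi> = 1" "x0 = \<phi> *s y0"
  proof (cases "y0 = 0")
    case True
    then have "x0 = 0" using n0 by (simp add: cip_self)
    then show thesis using that[of 1] True by simp
  next
    case False
    define c where "c = cip y0 x0 / cip y0 y0"
    have "cip y0 y0 \<noteq> 0" using False by (simp add: cip_self)
    have ey0: "cip e y0 = 0" by (simp add: e_def cip_simps gy0 dy0)
    have "x0 - c *s y0 = 0"
      by (rule orthogonal_triple_complete[OF d e(1) False e(2) dy0 ey0])
         (use \<open>cip y0 y0 \<noteq> 0\<close> in \<open>simp_all add: cip_simps dx0 dy0 ex0 ey0 c_def\<close>)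
    then have c: "x0 = c *s y0" by simp
    have "c * cnj c * cip y0 y0 = cip y0 y0" using n0 by (simp add: c cip_simps mult_ac)
    then have "c * cnj c = 1" using \<open>cip y0 y0 \<noteq> 0\<close> by simp
    then have "cmod c = 1" by (metis abs_norm_cancel abs_square_eq_1 complex_norm_square of_real_eq_1_iff)
    then show thesis using that c by blast
  qed
  have \<phi>\<phi>: "\<phi> * cnj \<phi> = 1" using \<phi>(1) by (metis complex_norm_square of_real_1 one_power2)
  \<comment> \<open>Comparing the coefficients of \<open>d\<close> in \<open>K\<close> forces this
    value; those of \<open>g\<close> then agree because \<open>\<phi>\<close> is a phase.\<close>
  define z where "z = a - \<phi> * cnj b"
  define g' where "g' = \<phi> *s g"
  have K: "adj B *v g' + z *s d = B *v d + cnj z *s g'"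
  proof -
    have "adj B *v g' = x0 + (\<phi> * cnj a) *s g + (\<phi> * cnj b) *s d"
      unfolding \<phi>(2) g'_def vector_scalar_commute y_def[symmetric] by (subst ye) (simp add: vec_eq_iff algebra_simps)
    moreover have "cnj z * \<phi> = \<phi> * cnj a - b" using \<phi>\<phi> by (simp add: z_def algebra_simps)
    then have "cnj z *s g' = (\<phi> * cnj a - b) *s g" by (simp add: g'_def vector_smult_assoc)
    moreover have "B *v d = x0 + a *s d + b *s g" using xe by (simp add: x_def)
    ultimately show ?thesis by (simp add: z_def vec_eq_iff algebra_simps)
  qed
  have gg': "outer g' g' = outer g g"
    using \<phi>\<phi> by (simp add: vec_eq_iff g'_def mult_ac)

  \<comment> \<open>The bordered matrix. In its normality \<open>eq\<close> is the upper left block,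
    \<open>K\<close> the off-diagonal one, and the equal norms of \<open>d\<close> and
    \<open>g'\<close> the lower right one.\<close>
  define N where "N = (\<lambda>w. (B *v fst w + snd w *s g', cip d (fst w) + z * snd w))"
  define N' where "N' = (\<lambda>w. (adj B *v fst w + snd w *s d, cip g' (fst w) + cnj z * snd w))"
  define J where "J = (\<lambda>w::(complex^3) \<times> complex. (\<i> *s fst w, \<i> * snd w))"
  \<comment> \<open>Restricting to the range of \<open>P\<close> plus the extra coordinate ensures
    \<open>P *v f = f\<close>.\<close>
  define S where "S = {w::(complex^3) \<times> complex. P *v fst w = fst w}"
  have cipR: "cip u (r *\<^sub>R v) = r *\<^sub>R cip u v" for u v :: "complex^3" and r
    by (simp add: scaleR_eq_scale cip_simps scaleR_conv_of_real)
  have sm: "(r *\<^sub>R s) *s v = r *\<^sub>R (s *s v)" "s *s (r *\<^sub>R v) = r *\<^sub>R (s *s v)"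
    for r s and v :: "complex^3"
    by (simp_all only: vec_eq_iff vector_smult_component vector_scaleR_component) simp_all
  have "linear N"
    by (rule linearI) (simp_all add: N_def matrix_vector_right_distrib matrix_vec_scaleR cip_simps cipR sm
        scaleR_add_right distrib_left vector_sadd_rdistrib)
  moreover have "linear N'"
    by (rule linearI) (simp_all add: N'_def matrix_vector_right_distrib matrix_vec_scaleR cip_simps cipR sm
        scaleR_add_right distrib_left vector_sadd_rdistrib)
  moreover have "linear J"
    by (rule linearI) (simp_all add: J_def vector_add_ldistrib sm distrib_left)
  moreover have "subspace S"
    by (simp add: subspace_def S_def matrix_vector_right_distrib matrix_vec_scaleR)
  moreover have "(0, 1) \<in> S" by (simp add: S_def)
  then have "S \<noteq> {0}" by (auto simp: zero_prod_def)
  moreover have PB': "P *v (B *v v) = B *v v" "P *v (adj B *v v) = adj B *v v" for v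
    by (simp_all add: matrix_vector_mul_assoc PB)
  then have "N w \<in> S" "N' w \<in> S" for w
    by (simp_all add: S_def N_def N'_def matrix_vector_right_distrib vector_scalar_commute Pd Pg g'_def)
  moreover have "J w \<in> S" if "w \<in> S" for w using that by (simp add: S_def J_def vector_scalar_commute)
  moreover have "v \<bullet> N w = N' v \<bullet> w" for v w
  proof -
    have re: "s \<bullet> t = Re (cnj s * t)" for s t :: complex by (simp add: inner_complex_def)
    have "v \<bullet> N w = Re (cip (fst v) (B *v fst w + snd w *s g') + cnj (snd v) * (cip d (fst w) + z * snd w))"
      by (simp add: N_def inner_prod_def re Re_cip)
    also have "\<dots> = Re (cip (adj B *v fst v + snd v *s d) (fst w) + cnj (cip g' (fst v) + cnj z * snd v) * snd w)"
      by (simp add: cip_simps cip_adj cip_commute[of g' "fst v"] algebra_simps)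
    also have "\<dots> = N' v \<bullet> w" by (simp add: N'_def inner_prod_def re Re_cip)
    finally show ?thesis .
  qed
  moreover have "N (N' w) = N' (N w)" for w
  proof -
    have 1: "(?X + outer d d) *v fst w = (?Y + outer g' g') *v fst w" by (simp only: gg' eq)
    have "cip (adj B *v g' + z *s d) (fst w) = cip (B *v d + cnj z *s g') (fst w)" by (simp only: K)
    then have 2: "cip g' (B *v fst w) + cnj z * cip d (fst w) = cip d (adj B *v fst w) + z * cip g' (fst w)"
      by (simp add: cip_simps cip_adj)
    have mg': "cip g' g' = m" using \<phi>\<phi> by (simp add: g'_def cip_simps mg)
    have "fst (N (N' w)) = (B *v (adj B *v fst w) + cip g' (fst w) *s g') + snd w *s (B *v d + cnj z *s g')"
      by (simp add: N_def N'_def matrix_vector_right_distrib vector_scalar_commute vector_add_ldistrib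
          vector_sadd_rdistrib vector_smult_assoc mult.commute add_ac)
    also have "B *v (adj B *v fst w) + cip g' (fst w) *s g' = adj B *v (B *v fst w) + cip d (fst w) *s d"
      using 1 by (simp add: matrix_vector_mult_add_rdistrib outer_vec matrix_vector_mul_assoc)
    also have "\<dots> + snd w *s (B *v d + cnj z *s g') = fst (N' (N w))"
      unfolding K[symmetric]
      by (simp add: N_def N'_def matrix_vector_right_distrib vector_scalar_commute vector_add_ldistrib
          vector_sadd_rdistrib vector_smult_assoc mult.commute add_ac)
    finally have "fst (N (N' w)) = fst (N' (N w))" .
    moreover have "snd (N (N' w)) = snd (N' (N w))"
      using 2 by (simp add: N_def N'_def cip_simps mg' m_def[symmetric] algebra_simps)
    ultimately show ?thesis by (simp add: prod_eq_iff)
  qed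
  moreover have "J (J w) = - w" for w by (simp add: J_def vector_smult_assoc prod_eq_iff vec_eq_iff)
  moreover have "J v \<bullet> w = - (v \<bullet> J w)" for v w
    by (simp add: J_def inner_prod_def inner_imult inner_complex_def)
  moreover have "J (N w) = N (J w)" "J (N' w) = N' (J w)" for w
    by (simp_all add: J_def N_def N'_def vector_add_ldistrib vector_scalar_commute cip_simps vector_smult_assoc algebra_simps)
  ultimately obtain w r i where w: "w \<in> S" "w \<noteq> 0" "N w = r *\<^sub>R w - i *\<^sub>R J w" "N' w = r *\<^sub>R w + i *\<^sub>R J w"
    by (rule normal_eigenvector[of N N' J S])
  define \<beta> where "\<beta> = complex_of_real r + \<i> * complex_of_real i"
  have 1: "B *v fst w + snd w *s g' = cnj \<beta> *s fst w"
    using arg_cong[OF w(3), of fst]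
    by (simp add: N_def J_def \<beta>_def scaleR_eq_scale vector_smult_assoc vec_eq_iff algebra_simps)
  have 2: "adj B *v fst w + snd w *s d = \<beta> *s fst w"
    using arg_cong[OF w(4), of fst]
    by (simp add: N'_def J_def \<beta>_def scaleR_eq_scale vector_smult_assoc vec_eq_iff algebra_simps)
  have "fst w \<noteq> 0"
  proof
    assume 0: "fst w = 0"
    then have "snd w \<noteq> 0" using w(2) by (auto simp: prod_eq_iff)
    moreover have "g' \<noteq> 0" using g0 \<phi>\<phi> by (auto simp: g'_def)
    ultimately show False using 1 0 by simp
  qed
  moreover have "P *v fst w = fst w" using w(1) by (simp add: S_def)
  moreover have "\<beta> *s fst w - adj B *v fst w = snd w *s d" using 2 by (simp add: algebra_simps)
  moreover have "cnj \<beta> *s fst w - B *v fst w = (snd w * \<phi>) *s g"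
    unfolding 1[symmetric] by (simp add: g'_def vector_smult_assoc)
  ultimately show thesis by (rule that)
qed

subsection \<open>Roots of mixed cubic polynomials\<close>

text \<open>For small \<open>\<epsilon>\<close> the map \<open>z \<mapsto> z - \<epsilon> p(z)\<close> sends a large disc into itself.\<close>

lemma mixed_cubic_root:
  fixes c c1 c2 c3 c4 c5 :: complex
  assumes "c \<noteq> 0"
  obtains z where "c * (cnj z * z\<^sup>2) + c1 * (cnj z * z) + c2 * cnj z + c3 * z\<^sup>2 + c4 * z + c5 = 0"
proof -
  define q where "q z = (c1 * (cnj z * z) + c2 * cnj z + c3 * z\<^sup>2 + c4 * z + c5) / c" for z
  define K where "K = (cmod c1 + cmod c2 + cmod c3 + cmod c4 + cmod c5) / cmod c"
  \<comment> \<open>The estimate splits at \<open>R / 2\<close>. Below it the error is at most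
    \<open>2 * K\<close>, which is less than \<open>R / 2\<close>; above it \<open>1 \<le> r\<close>
    and \<open>2 * K \<le> r\<close>, and the contraction absorbs the error.\<close>
  define R where "R = 4 * K + 2"
  have K: "0 \<le> K" by (simp add: K_def)
  then have R: "2 \<le> R" by (simp add: R_def)
  have q: "cmod (q z) \<le> K * (1 + (cmod z)\<^sup>2)" for z
  proof -
    have le: "cmod z \<le> 1 + (cmod z)\<^sup>2"
      using sum_squares_ge_zero[of "cmod z - 1/2" 0] by (simp add: power2_eq_square algebra_simps)
    have "cmod (c1 * (cnj z * z) + c2 * cnj z + c3 * z\<^sup>2 + c4 * z + c5)
      \<le> cmod c1 * (cmod z)\<^sup>2 + cmod c2 * cmod z + cmod c3 * (cmod z)\<^sup>2 + cmod c4 * cmod z + cmod c5"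
      by (intro norm_triangle_le add_mono) (simp_all add: norm_mult norm_power power2_eq_square)
    also have "\<dots> \<le> (cmod c1 + cmod c2 + cmod c3 + cmod c4 + cmod c5) * (1 + (cmod z)\<^sup>2)"
      unfolding ring_distribs(2)
      using mult_left_mono[OF le, of "cmod c2"] mult_left_mono[OF le, of "cmod c4"]
      by (intro add_mono) (auto simp: algebra_simps)
    finally show ?thesis using assms by (simp add: q_def K_def norm_divide field_simps)
  qed
  define F where "F z = z - (cnj z * z\<^sup>2 + q z) / complex_of_real (R\<^sup>2)" for z
  have "continuous_on (cball 0 R) F"
    unfolding F_def q_def using assms R by (intro continuous_intros) auto
  moreover have "F z \<in> cball 0 R" if "z \<in> cball 0 R" for z
  proof -
    define r where "r = cmod z"
    have r: "0 \<le> r" "r \<le> R" using that by (auto simp: r_def)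
    \<comment> \<open>The leading term is a nonnegative multiple of \<open>z\<close>, so subtracting
      it pulls radially inwards.\<close>
    have zz: "cnj z * z\<^sup>2 = complex_of_real (r\<^sup>2) * z"
      using complex_norm_square[of z] by (simp add: r_def power2_eq_square mult_ac)
    have rR: "r\<^sup>2 \<le> R\<^sup>2" using r by (simp add: power_mono)
    have "F z = complex_of_real (1 - r\<^sup>2 / R\<^sup>2) * z - q z / complex_of_real (R\<^sup>2)"
      using R by (simp add: F_def zz field_simps)
    then have "cmod (F z) \<le> cmod (complex_of_real (1 - r\<^sup>2 / R\<^sup>2) * z) + cmod (q z / complex_of_real (R\<^sup>2))"
      by (metis norm_triangle_ineq4)
    also have "cmod (complex_of_real (1 - r\<^sup>2 / R\<^sup>2) * z) = (1 - r\<^sup>2 / R\<^sup>2) * r"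
      using rR R by (simp add: norm_mult r_def del: of_real_diff of_real_divide)
    also have "cmod (q z / complex_of_real (R\<^sup>2)) \<le> K * (1 + r\<^sup>2) / R\<^sup>2"
      using q[of z] R by (simp add: norm_divide norm_power r_def divide_right_mono)
    also have "(1 - r\<^sup>2 / R\<^sup>2) * r + K * (1 + r\<^sup>2) / R\<^sup>2 \<le> R"
    proof (cases "r \<le> R / 2")
      case True
      have "(1 - r\<^sup>2 / R\<^sup>2) * r \<le> 1 * r" using r by (intro mult_right_mono) auto
      moreover have "1 \<le> R\<^sup>2" using R by (simp add: one_le_power)
      then have "K * (1 + r\<^sup>2) \<le> K * (2 * R\<^sup>2)" using rR K by (intro mult_left_mono) auto
      then have "K * (1 + r\<^sup>2) / R\<^sup>2 \<le> 2 * K" using R by (simp add: field_simps)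
      ultimately show ?thesis using True by (simp add: R_def)
    next
      case False
      then have r1: "1 \<le> r" "2 * K \<le> r" using K by (simp_all add: R_def)
      have "K * (1 + r\<^sup>2) \<le> K * (2 * r\<^sup>2)" using r1(1) K by (intro mult_left_mono) (auto simp: one_le_power)
      also have "\<dots> = (2 * K) * r\<^sup>2" by simp
      also have "\<dots> \<le> r * r\<^sup>2" using r1(2) by (intro mult_right_mono) auto
      finally have "K * (1 + r\<^sup>2) / R\<^sup>2 \<le> r * r\<^sup>2 / R\<^sup>2" by (simp add: divide_right_mono)
      then show ?thesis using r by (simp add: algebra_simps)
    qed
    finally show ?thesis by simp
  qed
  ultimately obtain z where "F z = z"
    using brouwer_ball[of R 0 F] R by (metis Pi_I less_le_trans zero_less_numeral)
  then have "cnj z * z\<^sup>2 + q z = 0" using R by (simp add: F_def)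
  then have "c * (cnj z * z\<^sup>2) + c * q z = 0" by (simp add: distrib_left[symmetric])
  moreover have "c * q z = c1 * (cnj z * z) + c2 * cnj z + c3 * z\<^sup>2 + c4 * z + c5"
    using assms by (simp add: q_def)
  ultimately show thesis by (intro that[of z]) (simp add: add.assoc)
qed

subsection \<open>Defects of rank two\<close>

definition det3 :: "complex^3 \<Rightarrow> complex^3 \<Rightarrow> complex^3 \<Rightarrow> complex" where
  "det3 u v w = u$1 * (v$2 * w$3 - v$3 * w$2) - u$2 * (v$1 * w$3 - v$3 * w$1) + u$3 * (v$1 * w$2 - v$2 * w$1)"

lemma det3_zero_orthogonal:
  assumes "det3 u v w = 0"
  obtains f where "f \<noteq> 0" "cip u f = 0" "cip v f = 0" "cip w f = 0"
proof -
  define M :: "complex^3^3" where "M = (\<chi> i j. cnj ((if i = 1 then u else if i = 2 then v else w) $ j))"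
  have "det M = cnj (det3 u v w)" by (simp add: det_3 M_def det3_def algebra_simps)
  then have "\<not> invertible M" using assms by (simp add: invertible_det_nz)
  then obtain f where "M *v f = 0" "f \<noteq> 0"
    using invertible_left_inverse matrix_left_invertible_ker by blast
  moreover have "(M *v f) $ 1 = cip u f" "(M *v f) $ 2 = cip v f" "(M *v f) $ 3 = cip w f"
    by (simp_all add: matrix_vector_mult_def M_def cip_def)
  ultimately show thesis using that by simp
qed

text \<open>With \<open>g1\<close>, \<open>g2\<close> spanning the complement of \<open>g\<close>,
  the equations say that \<open>f\<close> is orthogonal to three vectors depending on
  \<open>\<beta>\<close>. Their determinant is a mixed cubic with leading coefficient
  \<open>det3 h g1 g2\<close>, which is nonzero because \<open>h\<close> is not orthogonal to
  \<open>g\<close>.\<close>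

lemma rank_two_defect_eigenvector:
  fixes B :: "complex^3^3" and g h :: "complex^3"
  assumes hg: "cip h g \<noteq> 0"
  obtains f \<beta> s where "f \<noteq> 0" "cip h (\<beta> *s f - adj B *v f) = 0" "cnj \<beta> *s f - B *v f = s *s g"
proof -
  have g0: "g \<noteq> 0" using hg by auto
  obtain g1 where g1: "g1 \<noteq> 0" "cip g g1 = 0"
    using complex_orthogonal_exists[of "{g}"] by auto
  have "card {g, g1} < CARD(3)" by (simp add: card_insert_if)
  then obtain g2 where g2: "g2 \<noteq> 0" "cip g g2 = 0" "cip g1 g2 = 0"
    using complex_orthogonal_exists[of "{g, g1}"] by (metis finite.emptyI finite.insertI insertI1 insert_commute)
  have gmult: "\<exists>s. v = s *s g" if "cip g1 v = 0" "cip g2 v = 0" for v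
  proof
    have "cip g g \<noteq> 0" using g0 by (simp add: cip_self)
    moreover have "cip g1 g = 0" "cip g2 g = 0" using g1 g2 by (metis cip_commute complex_cnj_zero)+
    ultimately have "v - (cip g v / cip g g) *s g = 0"
      by (intro orthogonal_triple_complete[OF g0 g1(1) g2(1) g1(2) g2(2) g2(3)]) (simp_all add: cip_simps that)
    then show "v = (cip g v / cip g g) *s g" by simp
  qed
  have "det3 h g1 g2 \<noteq> 0"
  proof
    assume "det3 h g1 g2 = 0"
    then obtain f where f: "f \<noteq> 0" "cip h f = 0" "cip g1 f = 0" "cip g2 f = 0"
      by (rule det3_zero_orthogonal)
    then obtain s where "f = s *s g" using gmult by blast
    then show False using f hg by (simp add: cip_simps)
  qed
  define h' where "h' = B *v h"
  define k1 where "k1 = adj B *v g1"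
  define k2 where "k2 = adj B *v g2"
  obtain z where z: "det3 h g1 g2 * (cnj z * z\<^sup>2) + (- det3 h g1 k2 - det3 h k1 g2) * (cnj z * z)
      + det3 h k1 k2 * cnj z + (- det3 h' g1 g2) * z\<^sup>2 + (det3 h' g1 k2 + det3 h' k1 g2) * z + (- det3 h' k1 k2) = 0"
    using mixed_cubic_root[OF \<open>det3 h g1 g2 \<noteq> 0\<close>] by metis
  have "det3 (cnj z *s h - h') (z *s g1 - k1) (z *s g2 - k2) = 0"
    unfolding z[symmetric] det3_def power2_eq_square vector_minus_component vector_smult_component by algebra
  then obtain f where f: "f \<noteq> 0" "cip (cnj z *s h - h') f = 0" "cip (z *s g1 - k1) f = 0" "cip (z *s g2 - k2) f = 0"
    by (rule det3_zero_orthogonal)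
  have "cip h (z *s f - adj B *v f) = 0"
    using f(2) by (simp add: cip_simps h'_def cip_adj)
  moreover have "cip g1 (cnj z *s f - B *v f) = 0" "cip g2 (cnj z *s f - B *v f) = 0"
    using f(3,4) by (simp_all add: cip_simps k1_def k2_def cip_adj)
  then obtain s where "cnj z *s f - B *v f = s *s g" using gmult by blast
  ultimately show thesis using that f(1) by blast
qed

subsection \<open>Woronowicz's theorem\<close>

definition psd_matrix :: "complex^'n^'n \<Rightarrow> bool" where
  "psd_matrix X \<longleftrightarrow> hermitian X \<and> (\<forall>u. 0 \<le> u \<bullet> (X *v u))"

lemma psd_matrix_null:
  assumes X: "psd_matrix X" and u: "u \<bullet> (X *v u) = 0"
  shows "X *v u = 0"
proof -
  have "((X *v u) \<bullet> (X *v u))\<^sup>2 \<le> ((X *v u) \<bullet> (X *v (X *v u))) * (u \<bullet> (X *v u))"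
    using X by (intro psd_cauchy_schwarz[OF linear_matrix_vec subspace_UNIV])
      (auto simp: psd_matrix_def hermitian_iff_adj inner_adj)
  then show ?thesis by (simp add: u)
qed

lemma matrix_vec_axis: "X *v axis j 1 = column j X" for X :: "complex^'n^'m"
  by (simp add: vec_eq_iff matrix_vector_mult_def axis_def column_def if_distrib cong: if_cong)

lemma matrix_vec_minus: "X *v (- v) = - (X *v v)" for X :: "complex^'n^'m"
  by (simp add: vec_eq_iff matrix_vector_mult_def sum_negf)

lemma Re_trace: "Re (trace X) = (\<Sum>i\<in>UNIV. axis i 1 \<bullet> (X *v axis i 1))" for X :: "complex^'n^'n"
  by (simp add: trace_def inner_axis' inner_complex_def matrix_vec_axis column_def)

lemma psd_matrix_trace_nonneg: "psd_matrix X \<Longrightarrow> 0 \<le> Re (trace X)"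
  unfolding Re_trace by (intro sum_nonneg) (simp add: psd_matrix_def)

lemma psd_matrix_trace_zero:
  assumes X: "psd_matrix X" and "Re (trace X) = 0"
  shows "X = 0"
proof -
  have "axis i 1 \<bullet> (X *v axis i 1) = 0" for i
    using assms sum_nonneg_eq_0_iff[of UNIV "\<lambda>i. axis i 1 \<bullet> (X *v axis i 1)"]
    unfolding Re_trace by (simp add: psd_matrix_def)
  then have "X *v axis i 1 = 0" for i by (rule psd_matrix_null[OF X])
  then show ?thesis by (simp add: matrix_vec_axis column_def vec_eq_iff)
qed

lemma psd_matrix_outer: "psd_matrix (outer p p)"
proof -
  have "0 \<le> u \<bullet> (outer p p *v u)" for u
  proof -
    have "u \<bullet> (outer p p *v u) = Re (cip p u * cnj (cip p u))"
      by (simp add: outer_vec Re_cip[symmetric] cip_simps cip_commute[of u p])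
    then show ?thesis by (simp add: complex_norm_square[symmetric])
  qed
  then show ?thesis by (simp add: psd_matrix_def hermitian_outer)
qed

section \<open>PPT matrices whose corner is a projection\<close>

locale normalized_ppt =
  fixes P B C :: "complex^3^3"
  assumes ppt: "ppt (P, B, C)" and adjP: "adj P = P" and PP: "P ** P = P"
    and CP: "\<And>f. P *v f = 0 \<Longrightarrow> C *v f = 0"
begin

text \<open>As \<open>P\<close> is a projection acting as the identity on the ranges of
  \<open>B\<close> and \<open>adj B\<close> (\<open>PX\<close>), these are the Schur complements of
  the matrix and of its partial transpose. By \<open>CP\<close> their ranges lie in that of
  \<open>P\<close>.\<close>

definition "D = C - adj B ** B"
definition "G = C - B ** adj B"

lemma psd: "block_psd (P, B, C)" "block_psd (P, adj B, C)"
  using ppt by (auto simp: ppt_def)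

lemma adjC: "adj C = C"
  using psd by (simp add: block_psd_def hermitian_iff_adj)

lemma kernel: assumes "P *v f = 0" shows "B *v f = 0" "adj B *v f = 0"
  using block_psd_null[OF psd(1), of "(f, 0)"] block_psd_null[OF psd(2), of "(f, 0)"] assms
  by (simp_all add: zero_prod_def)

lemma absorb: assumes "\<And>f. P *v f = 0 \<Longrightarrow> X *v f = 0" shows "X ** P = X"
proof (rule matrix_eqI)
  fix v
  have "P *v (v - P *v v) = 0"
    by (simp add: matrix_vector_mult_diff_distrib matrix_vector_mul_assoc PP)
  then have "X *v (v - P *v v) = 0" by (rule assms)
  then show "(X ** P) *v v = X *v v"
    by (simp add: matrix_vector_mult_diff_distrib matrix_vector_mul_assoc)
qed

lemma PX: "P ** B = B" "P ** adj B = adj B" "P ** C = C"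
proof -
  have "adj (adj B ** P) = adj (adj B)" "adj (B ** P) = adj B" "adj (C ** P) = adj C"
    using absorb[of "adj B"] absorb[of B] absorb[of C] kernel CP by simp_all
  then show "P ** B = B" "P ** adj B = adj B" "P ** C = C" by (simp_all add: adj_mult adjP adjC)
qed

lemma PXv: "P *v (B *v v) = B *v v" "P *v (adj B *v v) = adj B *v v"
  by (simp_all add: matrix_vector_mul_assoc PX)

lemma Dv: "D *v v = C *v v - adj B *v (B *v v)" and Gv: "G *v v = C *v v - B *v (adj B *v v)"
  by (simp_all add: D_def G_def matrix_vector_mult_diff_rdistrib matrix_vector_mul_assoc)

lemma PD: "P *v (D *v v) = D *v v" and PG: "P *v (G *v v) = G *v v"
  by (simp_all add: Dv Gv matrix_vector_mult_diff_distrib PXv) (simp_all add: matrix_vector_mul_assoc PX)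

lemma psd_D: "psd_matrix D" and psd_G: "psd_matrix G"
proof -
  have herm: "hermitian D" "hermitian G"
    by (simp_all add: hermitian_iff_adj D_def G_def adj_diff adj_mult adjC)
  \<comment> \<open>For a fixed second component \<open>u\<close> these first components minimise
    the two forms.\<close>
  have "0 \<le> (- (B *v u), u) \<bullet> bop (P, B, C) (- (B *v u), u)"
    "0 \<le> (- (adj B *v u), u) \<bullet> bop (P, adj B, C) (- (adj B *v u), u)" for u
    using psd unfolding block_psd_def by blast+
  then have "0 \<le> u \<bullet> (D *v u)" "0 \<le> u \<bullet> (G *v u)" for u
    by (simp_all add: matrix_vec_minus PXv Dv Gv)
  with herm show "psd_matrix D" "psd_matrix G" by (simp_all add: psd_matrix_def)
qed

lemma defect: "adj B ** B + D = B ** adj B + G"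
  by (simp add: D_def G_def)

lemma trace_D_G: "trace D = trace G"
  by (simp add: D_def G_def trace_sub trace_cyclic[of B])

text \<open>The product vector has first factor \<open>(0, 1)\<close>: the block matrix maps
  \<open>(- (B *v u), u)\<close> to \<open>(0, D *v u)\<close>, and its partial transpose behaves
  likewise with \<open>G\<close>.\<close>

lemma subtractable_common:
  assumes "D *v u = f" "G *v u' = f" "f \<noteq> 0"
  shows "product_subtractable (P, B, C)"
  by (rule product_subtractableI[OF ppt assms(3), of 0 1 "(- (B *v u), u)" "(- (adj B *v u'), u')"])
     (use assms(1,2) in \<open>simp_all add: matrix_vec_minus PXv Dv Gv\<close>)

text \<open>The product vector has first factor \<open>(1, \<beta>)\<close>: the block matrix maps
  \<open>(f - B *v u, u)\<close> to \<open>(f, adj B *v f + D *v u)\<close>, and its partial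
  transpose behaves likewise with \<open>G\<close>.\<close>

lemma subtractable_eigen:
  assumes "P *v f = f" "f \<noteq> 0" "\<beta> *s f - adj B *v f = D *v u" "cnj \<beta> *s f - B *v f = G *v u'"
  shows "product_subtractable (P, B, C)"
proof (rule product_subtractableI[OF ppt assms(2), of 1 \<beta> "(f - B *v u, u)" "(f - adj B *v u', u')"])
  have "\<beta> *s f = adj B *v f + D *v u" "cnj \<beta> *s f = B *v f + G *v u'"
    using assms(3,4) by (simp_all add: algebra_simps)
  then show "bop (P, B, C) (f - B *v u, u) = (1 *s f, \<beta> *s f)"
    "bop (pt (P, B, C)) (f - adj B *v u', u') = (cnj 1 *s f, cnj \<beta> *s f)"
    using assms(1) by (simp_all add: matrix_vector_mult_diff_distrib PXv Dv Gv)
qed simp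

text \<open>If \<open>g\<close> is orthogonal to \<open>h\<close>, it lies in both ranges. Otherwise
  \<open>rank_two_defect_eigenvector\<close> applies, and its \<open>f\<close> must be shown to lie
  in the range of \<open>P\<close>.\<close>

lemma subtractable_two_one:
  assumes h: "h \<noteq> 0" "\<And>x. cip h x = 0 \<Longrightarrow> \<exists>u. D *v u = x" and g: "g \<noteq> 0" "G = outer g g"
  shows "product_subtractable (P, B, C)"
proof -
  have rG: "\<exists>u. G *v u = s *s g" for s
  proof
    show "G *v ((s / cip g g) *s g) = s *s g"
      using g by (simp add: outer_vec cip_simps cip_self)
  qed
  show ?thesis
  proof (cases "cip h g = 0")
    case True
    then obtain u u' where "D *v u = g" "G *v u' = 1 *s g" using h(2) rG by metis
    then show ?thesis using g(1) subtractable_common by simp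
  next
    case False
    then obtain f \<beta> s where f: "f \<noteq> 0" "cip h (\<beta> *s f - adj B *v f) = 0" "cnj \<beta> *s f - B *v f = s *s g"
      by (rule rank_two_defect_eigenvector)
    obtain u where u: "\<beta> *s f - adj B *v f = D *v u" using h(2)[OF f(2)] by metis
    obtain u' where u': "cnj \<beta> *s f - B *v f = G *v u'" using rG[of s] f(3) by metis
    \<comment> \<open>The part of \<open>f\<close> in the kernel of \<open>P\<close> is orthogonal
      to the ranges of \<open>D\<close> and \<open>G\<close>. Hence it is a multiple of
      \<open>h\<close> orthogonal to \<open>g\<close>, which is only \<open>0\<close>.\<close>
    define e where "e = f - P *v f"
    have "P *v e = 0" by (simp add: e_def matrix_vector_mult_diff_distrib matrix_vector_mul_assoc PP)
    then have De: "D *v e = 0" "G *v e = 0" by (simp_all add: Dv Gv kernel CP)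
    have adjDG: "adj D = D" "adj G = G" using psd_D psd_G by (simp_all add: psd_matrix_def hermitian_iff_adj)
    have ortho: "cip e x = 0" if x0: "cip h x = 0" for x
    proof -
      obtain w where "D *v w = x" using h(2)[OF x0] by blast
      then show ?thesis using De(1) adjDG(1) cip_adj[of e D w] by simp
    qed
    define c where "c = cip h e / cip h h"
    have "cip h h \<noteq> 0" using h(1) by (simp add: cip_self)
    then have h0: "cip h (e - c *s h) = 0" by (simp add: cip_simps c_def)
    have "cip (e - c *s h) y = cip e y - cnj c * cip h y" for y
      by (simp only: cip_diff_left cip_scale_left)
    then have "cip (e - c *s h) (e - c *s h) = 0" by (simp only: h0 ortho[OF h0]) simp
    then have e: "e = c *s h" by (simp add: cip_self)
    obtain w where "G *v w = 1 *s g" using rG[of 1] by blast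
    then have "cip e g = 0" using De(2) adjDG(2) cip_adj[of e G w] by simp
    then have "e = 0" using False by (simp add: e cip_simps)
    then have "P *v f = f" by (simp add: e_def)
    then show ?thesis using subtractable_eigen f(1) u u' by blast
  qed
qed

end

lemma edge_normalized:
  fixes P B C :: "complex^3^3"
  assumes ppt: "ppt (P, B, C)" and P: "adj P = P" "P ** P = P" and ne: "(P, B, C) \<noteq> 0"
  shows "product_subtractable (P, B, C)"
proof (cases "\<exists>f. P *v f = 0 \<and> C *v f \<noteq> 0")
  case True
  \<comment> \<open>The case excluded by \<open>CP\<close>: both block matrices map
    \<open>(0, f)\<close> to \<open>(0, C *v f)\<close>, a product vector.\<close>
  then obtain f where f: "P *v f = 0" "C *v f \<noteq> 0" by blast
  have psd: "block_psd (P, B, C)" "block_psd (P, adj B, C)" using ppt by (auto simp: ppt_def)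
  have "B *v f = 0" "adj B *v f = 0"
    using block_psd_null[OF psd(1), of "(f, 0)"] block_psd_null[OF psd(2), of "(f, 0)"] f(1)
    by (simp_all add: zero_prod_def)
  then show ?thesis
    by (intro product_subtractableI[OF ppt f(2), of 0 1 "(0, f)" "(0, f)"]) simp_all
next
  case False
  interpret normalized_ppt P B C using assms False by unfold_locales auto
  \<comment> \<open>Partial transposition exchanges \<open>D\<close> and \<open>G\<close>, so only
    one order of unequal ranks needs an argument.\<close>
  interpret T: normalized_ppt P "adj B" C
    using assms False ppt_pt[of "(P, B, C)"] by unfold_locales auto
  have TD: "T.D = G" "T.G = D" by (simp_all add: T.D_def T.G_def D_def G_def)
  have "P \<noteq> 0"
  proof
    assume "P = 0"
    then have "B = 0" "C = 0" using kernel(1) CP by (auto intro: matrix_eqI)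
    then show False using \<open>P = 0\<close> ne by (simp add: zero_prod_def)
  qed
  have psds: "hermitian D" "\<And>u. 0 \<le> u \<bullet> (D *v u)" "hermitian G" "\<And>u. 0 \<le> u \<bullet> (G *v u)"
    using psd_D psd_G by (auto simp: psd_matrix_def)
  have DG0: "D = 0 \<longleftrightarrow> G = 0"
    using psd_matrix_trace_zero[OF psd_D] psd_matrix_trace_zero[OF psd_G] trace_D_G
    by (auto simp: trace_def[of 0])
  show ?thesis
  proof (rule psd_rank_cases[OF psds(1,2)])
    assume D0: "D = 0"
    then have G0: "G = 0" using DG0 by simp
    \<comment> \<open>Without defects \<open>B\<close> is normal and has a joint eigenvector with
      \<open>adj B\<close> in the range of \<open>P\<close>.\<close>
    define S where "S = {f. P *v f = f}"
    obtain v where "P *v v \<noteq> 0" using \<open>P \<noteq> 0\<close> matrix_eqI[of P 0] by auto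
    moreover have "P *v v \<in> S" by (simp add: S_def matrix_vector_mul_assoc PP)
    ultimately have S0: "S \<noteq> {0}" by blast
    have S: "subspace S"
      by (simp add: S_def subspace_def matrix_vector_right_distrib matrix_vec_scaleR)
    have J: "linear ((*s) \<i> :: complex^3 \<Rightarrow> _)"
      by (rule linearI) (simp_all add: scaleR_eq_scale vector_add_ldistrib vector_smult_assoc mult.commute)
    obtain f a b where f: "f \<in> S" "f \<noteq> 0" "B *v f = a *\<^sub>R f - b *\<^sub>R (\<i> *s f)"
      "adj B *v f = a *\<^sub>R f + b *\<^sub>R (\<i> *s f)"
    proof (rule normal_eigenvector[OF linear_matrix_vec[of B] linear_matrix_vec[of "adj B"] J S S0])
      show "B *v x \<in> S" "adj B *v x \<in> S" for x by (simp_all add: S_def PXv)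
      show "\<i> *s x \<in> S" if "x \<in> S" for x using that by (simp add: S_def vector_scalar_commute)
      show "x \<bullet> (B *v y) = (adj B *v x) \<bullet> y" for x y by (rule inner_adj)
      show "B *v (adj B *v x) = adj B *v (B *v x)" for x
        using defect by (simp add: D0 G0 matrix_vector_mul_assoc)
      show "\<i> *s (\<i> *s x) = - x" for x :: "complex^3" by (simp add: vec_eq_iff)
      show "(\<i> *s x) \<bullet> y = - (x \<bullet> (\<i> *s y))" for x y :: "complex^3" by (rule inner_imult)
      show "\<i> *s (B *v x) = B *v (\<i> *s x)" "\<i> *s (adj B *v x) = adj B *v (\<i> *s x)" for x
        by (simp_all add: vector_scalar_commute)
    qed blast
    define \<beta> where "\<beta> = complex_of_real a + \<i> * complex_of_real b"
    have "\<beta> *s f - adj B *v f = D *v 0" "cnj \<beta> *s f - B *v f = G *v 0"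
      by (simp_all add: f \<beta>_def scaleR_eq_scale vec_eq_iff algebra_simps)
    moreover have "P *v f = f" using f(1) by (simp add: S_def)
    ultimately show ?thesis using f(2) subtractable_eigen by blast
  next
    fix d assume d: "d \<noteq> 0" "D = outer d d"
    have rD: "D *v ((s / cip d d) *s d) = s *s d" for s
      using d by (simp add: outer_vec cip_simps cip_self)
    have G0: "G \<noteq> 0" using DG0 d rD[of 1] by auto
    show ?thesis
    proof (rule psd_rank_cases[OF psds(3,4)])
      fix g assume g: "g \<noteq> 0" "G = outer g g"
      have rG: "G *v ((s / cip g g) *s g) = s *s g" for s
        using g by (simp add: outer_vec cip_simps cip_self)
      show ?thesis
      proof (cases "\<exists>c. g = c *s d")
        case True
        then obtain c where "g = c *s d" by blast
        moreover have "G *v ((1 / cip g g) *s g) = g" using rG[of 1] by simp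
        ultimately show ?thesis using subtractable_common rD[of c] g(1) by metis
      next
        case False
        have "P *v d = d" "P *v g = g" using PD[of "(1 / cip d d) *s d"] PG[of "(1 / cip g g) *s g"]
          by (simp_all only: rD rG) simp_all
        then obtain f \<beta> s s' where "f \<noteq> 0" "P *v f = f" "\<beta> *s f - adj B *v f = s *s d"
          "cnj \<beta> *s f - B *v f = s' *s g"
          using rank_one_defect_eigenvector[OF defect[unfolded d(2) g(2)] PX(1,2)] d(1) False by metis
        then show ?thesis using subtractable_eigen rD rG by metis
      qed
    next
      fix h assume "h \<noteq> 0" "\<And>x. cip h x = 0 \<Longrightarrow> \<exists>u. G *v u = x"
      then have "product_subtractable (P, adj B, C)"
        using T.subtractable_two_one[of h d] d by (simp add: TD)
      then show ?thesis using product_subtractable_pt[of "(P, B, C)"] by simp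
    qed (use G0 in simp)
  next
    fix h assume h: "h \<noteq> 0" "\<And>x. cip h x = 0 \<Longrightarrow> \<exists>u. D *v u = x"
    show ?thesis
    proof (rule psd_rank_cases[OF psds(3,4)])
      assume "G = 0"
      then have D0: "D = 0" using DG0 by simp
      obtain x where "x \<noteq> 0" "cip h x = 0" using complex_orthogonal_exists[of "{h}"] by auto
      then show ?thesis using h(2)[of x] D0 by auto
    next
      fix g assume "g \<noteq> 0" "G = outer g g"
      then show ?thesis using subtractable_two_one[OF h] by blast
    next
      fix h' assume h': "h' \<noteq> 0" "\<And>x. cip h' x = 0 \<Longrightarrow> \<exists>u. G *v u = x"
      have "card {h, h'} < CARD(3)" by (simp add: card_insert_if)
      then obtain x where "x \<noteq> 0" "cip h x = 0" "cip h' x = 0"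
        using complex_orthogonal_exists[of "{h, h'}"] by (metis finite.emptyI finite.insertI insertI1 insert_commute)
      then show ?thesis using subtractable_common h(2) h'(2) by metis
    qed
  qed
qed

lemma ppt_product_subtractable:
  fixes t :: "3 triple"
  assumes "ppt t" "t \<noteq> 0"
  shows "product_subtractable t"
proof -
  obtain A B C where t: "t = (A, B, C)" by (cases t)
  have bp: "block_psd (A, B, C)" using assms by (simp add: ppt_def t)
  have "0 \<le> u \<bullet> (A *v u)" for u
  proof -
    have "0 \<le> (u, 0) \<bullet> bop (A, B, C) (u, 0)" using bp unfolding block_psd_def by blast
    then show ?thesis by simp
  qed
  moreover have "hermitian A" using bp by (simp add: block_psd_def)
  ultimately obtain M N :: "complex^3^3" where M: "M ** N = mat 1" "N ** M = mat 1"
    "adj (adj M ** A ** M) = adj M ** A ** M"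
    "(adj M ** A ** M) ** (adj M ** A ** M) = adj M ** A ** M"
    using psd_congruence_projection by metis
  have "tcong M t \<noteq> 0"
  proof
    assume "tcong M t = 0"
    then have "tcong N (tcong M t) = 0" by (simp add: tcong_def zero_prod_def)
    then show False using assms(2) tcong_inverse[OF M(1)] by simp
  qed
  then have "product_subtractable (tcong M t)"
    using ppt_tcong[OF assms(1), of M] edge_normalized[OF _ M(3,4)] by (simp add: t tcong_def)
  then show ?thesis by (rule product_subtractable_tcong[OF M(1,2)])
qed

definition trt :: "('n::finite) triple \<Rightarrow> real" where
  "trt t = Re (trace (fst t)) + Re (trace (snd (snd t)))"

lemma block_psd_corners:
  assumes "block_psd (A, B, C)" shows "psd_matrix A" "psd_matrix C"
proof -
  have "0 \<le> (u, v) \<bullet> bop (A, B, C) (u, v)" for u v using assms unfolding block_psd_def by blast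
  from this[of _ 0] this[of 0] show "psd_matrix A" "psd_matrix C"
    using assms by (simp_all add: block_psd_def psd_matrix_def)
qed

lemma trt_pos:
  assumes "block_psd t" "t \<noteq> 0" shows "0 < trt t"
proof (rule ccontr)
  assume negL: "\<not> 0 < trt t"
  obtain A B C where t: "t = (A, B, C)" by (cases t)
  have AC: "psd_matrix A" "psd_matrix C" using block_psd_corners assms(1) by (auto simp: t)
  then have tr: "Re (trace A) = 0" "Re (trace C) = 0"
    using psd_matrix_trace_nonneg[OF AC(1)] psd_matrix_trace_nonneg[OF AC(2)] negL by (simp_all add: trt_def t)
  then have A0: "A = 0" and C0: "C = 0" using psd_matrix_trace_zero AC by blast+
  have "B *v v = 0" for v
    using block_psd_null[OF assms(1), of "(0, v)"] by (simp add: t A0 C0 zero_prod_def)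
  then have "B = 0" by (intro matrix_eqI) simp
  then show False using assms(2) by (simp add: t A0 C0 zero_prod_def)
qed

lemma linear_bop_left: "linear (\<lambda>t. bop t x)"
  by (rule linearI) (simp_all add: bop_add bop_scaleR)

lemma closed_ppt: "closed {t :: ('n::finite) triple. ppt t}"
proof -
  have "closed {t :: ('n::finite) triple. block_psd t}"
  proof -
    have c: "continuous_on UNIV (\<lambda>t :: ('n::finite) triple. bop t x)" for x
      by (simp add: linear_bop_left linear_continuous_on linear_conv_bounded_linear[symmetric])
    have a: "continuous_on UNIV (adj :: complex^'n^'n \<Rightarrow> _)"
      by (simp add: linear_adj linear_continuous_on linear_conv_bounded_linear[symmetric])
    show ?thesis
      unfolding block_psd_def hermitian_iff_adj
      by (intro closed_Collect_conj closed_Collect_all closed_Collect_eq closed_Collect_le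
          continuous_intros c continuous_on_compose2[OF a]) auto
  qed
  moreover have "continuous_on UNIV (pt :: ('n::finite) triple \<Rightarrow> _)"
  proof -
    have "linear (pt :: ('n::finite) triple \<Rightarrow> _)"
      by (rule linearI) (auto simp: pt_def adj_add adj_scaleR)
    then show ?thesis by (simp add: linear_continuous_on linear_conv_bounded_linear[symmetric])
  qed
  ultimately show ?thesis
    using closed_Int[OF _ closed_vimage, of "{t. block_psd t}" "{t. block_psd t}" pt]
    by (simp add: ppt_def Collect_conj_eq vimage_def)
qed

text \<open>At a minimiser of \<open>L / trt\<close> with negative minimum no product vector could be subtracted.\<close>

theorem woronowicz:
  fixes L :: "3 triple \<Rightarrow> real"
  assumes L: "linear L" and prod: "\<And>a b f. 0 \<le> L (rk1 (a *s f) (b *s f))" and t: "ppt t"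
  shows "0 \<le> L t"
proof (rule ccontr)
  assume negL: "\<not> 0 \<le> L t"
  interpret linear L by fact
  let ?K = "{t :: 3 triple. ppt t} \<inter> sphere 0 1"
  have tr: "linear (trt :: 3 triple \<Rightarrow> real)"
    by (rule linearI) (simp_all add: trt_def trace_add trace_def sum_distrib_left sum.distrib algebra_simps)
  interpret tr: linear "trt :: 3 triple \<Rightarrow> real" by (rule tr)
  have pos: "0 < trt s" if "ppt s" "s \<noteq> 0" for s :: "3 triple"
    using that trt_pos unfolding ppt_def by blast
  have scaled: "s /\<^sub>R norm s \<in> ?K" if s: "ppt s" "s \<noteq> 0" for s :: "3 triple"
  proof -
    have "block_psd (r *\<^sub>R u)" if "block_psd u" "0 \<le> r" for u :: "3 triple" and r
      using that unfolding block_psd_def by (simp only: bop_scaleR hermitian_iff_adj adj_scaleR inner_scaleR_right fst_scaleR snd_scaleR) simp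
    then show ?thesis using s by (simp add: ppt_def pt_scaleR)
  qed
  have "t \<noteq> 0"
  proof
    assume "t = 0"
    then have "L t = 0" by (simp only: linear_0[OF L])
    then show False using negL by simp
  qed
  have "compact ?K" by (intro closed_Int_compact closed_ppt compact_sphere)
  moreover have "?K \<noteq> {}" using scaled[OF t \<open>t \<noteq> 0\<close>] by blast
  moreover have "continuous_on ?K (\<lambda>t. L t / trt t)"
  proof (intro continuous_intros linear_continuous_on linear_conv_bounded_linear[THEN iffD1] L tr ballI)
    fix s :: "3 triple" assume "s \<in> ?K"
    then have "ppt s" "s \<noteq> 0" by auto
    then show "trt s \<noteq> 0" using pos[of s] by simp
  qed
  ultimately obtain s where s: "s \<in> ?K" and min: "\<And>u. u \<in> ?K \<Longrightarrow> L s / trt s \<le> L u / trt u"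
    using continuous_attains_inf[of ?K "\<lambda>t. L t / trt t"] by blast
  define m where "m = L s / trt s"
  have ge: "m * trt u \<le> L u" if "ppt u" for u
  proof (cases "u = 0")
    case False
    have "m \<le> L u / trt u" using min[OF scaled[OF that False]] False by (simp add: m_def scale tr.scale)
    then show ?thesis using pos[OF that False] by (simp add: field_simps)
  qed (simp add: zero tr.zero)
  have "m * trt t < 0" using ge[OF t] negL by simp
  then have m: "m < 0" using pos[OF t \<open>t \<noteq> 0\<close>] by (simp add: mult_less_0_iff)
  have s': "ppt s" "s \<noteq> 0" using s by auto
  then obtain a b f e where f: "f \<noteq> 0" "a \<noteq> 0 \<or> b \<noteq> 0" "0 < e" "ppt (s - e *\<^sub>R rk1 (a *s f) (b *s f))"
    using ppt_product_subtractable by (metis product_subtractable_def)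
  let ?p = "rk1 (a *s f) (b *s f)"
  have "trt ?p = Re ((a * cnj a + b * cnj b) * cip f f)"
    by (simp add: trt_def rk1_def trace_outer_only cip_simps algebra_simps)
  also have "\<dots> = ((cmod a)\<^sup>2 + (cmod b)\<^sup>2) * (norm f)\<^sup>2"
    unfolding cip_self complex_norm_square[symmetric] by (simp flip: of_real_power)
  also have "\<dots> > 0" using f(1,2) by (auto intro!: mult_pos_pos simp: add_pos_nonneg add_nonneg_pos)
  finally have "m * trt ?p < L ?p" using prod[of a f b] m by (smt (verit) mult_neg_pos)
  moreover have "m * (trt s - e * trt ?p) \<le> L s - e * L ?p"
    using ge[OF f(4)] by (simp add: diff scale tr.diff tr.scale)
  moreover have "L s = m * trt s" using pos[OF s'] by (simp add: m_def)
  ultimately show False using f(3) by (simp add: algebra_simps)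
qed

subsection \<open>Duality for block-positive matrices\<close>

definition pairing :: "('n::finite) triple \<Rightarrow> 'n triple \<Rightarrow> real" where
  "pairing = (\<lambda>(X, Y, Z) (A, B, C).
     Re (trace (A ** X) + trace (B ** adj Y) + trace (adj B ** Y) + trace (C ** Z)))"

definition block_pos :: "('n::finite) triple \<Rightarrow> bool" where
  "block_pos X \<longleftrightarrow> hermitian (fst X) \<and> hermitian (snd (snd X)) \<and>
     (\<forall>a b f. 0 \<le> (a *s f, b *s f) \<bullet> bop X (a *s f, b *s f))"

lemma pairing_rk1: "pairing X (rk1 p q) = (p, q) \<bullet> bop X (p, q)"
  by (cases X) (simp add: pairing_def rk1_def trace_outer_left Re_cip inner_add_right)

lemma trace_scaleR: "trace (r *\<^sub>R A) = r *\<^sub>R trace A" for A :: "complex^'n^'n"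
  by (simp add: trace_def scaleR_right.sum)

lemma linear_pairing: "linear (pairing X)"
proof (rule linearI)
  show "pairing X (s + t) = pairing X s + pairing X t" for s t
    by (cases X; cases s; cases t) (simp add: pairing_def adj_add matrix_mul_add trace_add)
  show "pairing X (r *\<^sub>R t) = r *\<^sub>R pairing X t" for r t
    by (cases X; cases t) (simp add: pairing_def adj_scaleR matrix_mul_scaleR trace_scaleR distrib_left)
qed

lemma pairing_nonneg:
  assumes "block_pos X" "ppt t" shows "0 \<le> pairing X (t :: 3 triple)"
  using assms(1) unfolding block_pos_def
  by (intro woronowicz[OF linear_pairing _ assms(2)]) (simp only: pairing_rk1)

lemma complex_linear_cscale: "complex_linear T \<Longrightarrow> T (cscale c A) = cscale c (T A)"
  by (simp add: complex_linear_iff)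

definition ppt_map :: "(complex^'m^'m \<Rightarrow> complex^'n^'n) \<Rightarrow> bool" where
  "ppt_map T \<longleftrightarrow> complex_linear T \<and> (\<forall>A. T (adj A) = adj (T A)) \<and>
     (\<forall>u v. ppt (T (outer u u), T (outer u v), T (outer v v)))"

definition dual_map :: "(complex^'m^'m \<Rightarrow> complex^'n^'n) \<Rightarrow> complex^'n^'n \<Rightarrow> complex^'m^'m" where
  "dual_map T Z = (\<chi> j i. trace (T (mat_unit i j) ** Z))"

lemma trace_cscale: "trace (cscale c A ** B) = c * trace (A ** B)"
  by (simp add: trace_def matrix_matrix_mult_def sum_distrib_left mult.assoc)

lemma trace_sum_left: "trace ((\<Sum>i\<in>I. F i) ** B) = (\<Sum>i\<in>I. trace (F i ** B))"
  for B :: "complex^'n^'n"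
proof (induction I rule: infinite_finite_induct)
  case (insert x F)
  then show ?case by (simp add: matrix_mul_add trace_add)
qed (simp_all add: trace_def matrix_matrix_mult_def)

lemma trace_dual_map:
  assumes "complex_linear T"
  shows "trace (T X ** Z) = trace (X ** dual_map T Z)"
proof -
  have "trace (T X ** Z) = (\<Sum>i\<in>UNIV. \<Sum>j\<in>UNIV. X $ i $ j * trace (T (mat_unit i j) ** Z))"
    by (subst complex_linear_expansion[OF assms]) (simp add: trace_sum_left trace_cscale)
  then show ?thesis
    by (simp add: dual_map_def) (simp add: trace_def matrix_matrix_mult_def)
qed

lemma adj_mat_unit: "adj (mat_unit i j) = mat_unit j i"
  by (auto simp: vec_eq_iff mat_unit_def)

lemma adj_dual_map:
  assumes "\<And>A. T (adj A) = adj (T A)"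
  shows "adj (dual_map T Z) = dual_map T (adj Z)"
proof -
  have "cnj (trace (T A ** Z)) = trace (T (adj A) ** adj Z)" for A
    by (simp add: assms trace_adj[symmetric] adj_mult) (rule trace_cyclic)
  then show ?thesis by (simp add: dual_map_def vec_eq_iff adj_mat_unit)
qed

lemma ppt_map_pairing_nonneg:
  fixes S :: "complex^3^3 \<Rightarrow> complex^3^3"
  assumes S: "ppt_map S" and X: "block_pos (X1, X2, X3)" and Z: "block_pos (Z1, Z2, Z3)"
  shows "0 \<le> pairing (Z1, Z2, Z3) (S X1, S X2, S X3)"
proof -
  have lin: "complex_linear S" and herm: "S (adj A) = adj (S A)"
    and ppt: "ppt (S (outer u u), S (outer u v), S (outer v v))" for A u v
    using S by (auto simp: ppt_map_def)
  let ?d = "dual_map S"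
  note d = trace_dual_map[OF lin, symmetric]
  have adj_d: "adj (?d Z) = ?d (adj Z)" for Z by (rule adj_dual_map) (rule herm)
  have hZ: "adj Z1 = Z1" "adj Z3 = Z3" using Z by (simp_all add: block_pos_def hermitian_iff_adj)
  have "0 \<le> x \<bullet> bop (?d Z1, ?d Z2, ?d Z3) x" for x
  proof -
    obtain u v where x: "x = (u, v)" by (cases x)
    have "x \<bullet> bop (?d Z1, ?d Z2, ?d Z3) x = pairing (?d Z1, ?d Z2, ?d Z3) (rk1 u v)"
      by (simp add: pairing_rk1 x)
    also have "\<dots> = pairing (Z1, Z2, Z3) (S (outer u u), S (outer u v), S (outer v v))"
      by (simp add: pairing_def rk1_def adj_d d herm[symmetric])
    also have "\<dots> \<ge> 0" using Z ppt by (rule pairing_nonneg)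
    finally show ?thesis .
  qed
  moreover have "0 \<le> x \<bullet> bop (?d Z1, ?d (adj Z2), ?d Z3) x" for x
  proof -
    obtain u v where x: "x = (u, v)" by (cases x)
    have "x \<bullet> bop (?d Z1, ?d (adj Z2), ?d Z3) x = pairing (?d Z1, ?d (adj Z2), ?d Z3) (rk1 u v)"
      by (simp add: pairing_rk1 x)
    also have "\<dots> = pairing (Z1, Z2, Z3) (pt (S (outer u u), S (outer u v), S (outer v v)))"
      by (simp add: pairing_def rk1_def adj_d d herm[symmetric])
    also have "\<dots> \<ge> 0" using Z ppt by (intro pairing_nonneg) (simp_all only: ppt_pt)
    finally show ?thesis .
  qed
  ultimately have "ppt (?d Z1, ?d Z2, ?d Z3)"
    by (simp add: ppt_def block_psd_def hermitian_iff_adj adj_d hZ del: split_paired_All)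
  then have "0 \<le> pairing (X1, X2, X3) (?d Z1, ?d Z2, ?d Z3)" using X by (intro pairing_nonneg)
  also have "\<dots> = pairing (Z1, Z2, Z3) (S X1, S X2, S X3)"
    by (simp add: pairing_def adj_d trace_cyclic[of "?d _"] d herm[symmetric])
  finally show ?thesis .
qed

lemma trace_adj_mult: "trace (A ** B ** adj D) = (\<Sum>k\<in>UNIV. cip (column k D) (A *v column k B))"
  for A B D :: "complex^'n^'n"
proof -
  have "trace (A ** B ** adj D) = trace (adj D ** (A ** B))" by (rule trace_cyclic)
  also have "\<dots> = (\<Sum>k\<in>UNIV. (adj D ** (A ** B)) $ k $ k)" by (simp add: trace_def)
  finally show ?thesis by (simp add: adj_mult_nth column_mult)
qed

text \<open>A 2-positive map from 3 by 3 matrices to itself is decomposable (Yang, Leung and Tang): the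
  Schur complement of its Choi matrix with respect to one diagonal block is a positive map on
  2 by 2 matrices.\<close>

definition two_block_pos :: "(3 \<Rightarrow> 3 \<Rightarrow> complex^3^3) \<Rightarrow> bool" where
  "two_block_pos W \<longleftrightarrow> (\<forall>i j. adj (W i j) = W j i) \<and>
     (\<forall>e e' f g. 0 \<le> (\<Sum>i\<in>UNIV. \<Sum>j\<in>UNIV.
        (e i *s f + e' i *s g) \<bullet> (W i j *v (e j *s f + e' j *s g))))"

lemma two_block_pos_pairing_definite:
  fixes W C :: "3 \<Rightarrow> 3 \<Rightarrow> complex^3^3"
  assumes W: "two_block_pos W" and pd: "\<And>u. u \<noteq> 0 \<Longrightarrow> 0 < u \<bullet> (W 1 1 *v u)"
    and Cpos: "\<And>w. 0 \<le> (\<Sum>i\<in>UNIV. \<Sum>j\<in>UNIV. w i \<bullet> (C i j *v w j))"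
    and C: "adj (C 2 3) = C 3 2" "ppt (C 2 2, C 2 3, C 3 3)"
  shows "0 \<le> Re (\<Sum>i\<in>UNIV. \<Sum>j\<in>UNIV. trace (C i j ** W j i))"
proof -
  have adjW: "adj (W i j) = W j i" for i j using W by (simp add: two_block_pos_def)
  have W1: "0 \<le> u \<bullet> (W 1 1 *v u)" for u using pd[of u] by (cases "u = 0") auto
  have "hermitian (W 1 1)" by (simp add: hermitian_iff_adj adjW)
  from psd_congruence_projection[OF this W1] obtain M N :: "complex^3^3" where M: "M ** N = mat 1" "N ** M = mat 1"
    and P: "(adj M ** W 1 1 ** M) ** (adj M ** W 1 1 ** M) = adj M ** W 1 1 ** M"
    by blast
  let ?P = "adj M ** W 1 1 ** M"
  have "?P *v x = x" for x
  proof -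
    define y where "y = x - ?P *v x"
    have "?P *v y = 0" by (simp add: y_def matrix_vector_mult_diff_distrib matrix_vector_mul_assoc P)
    then have "y \<bullet> (?P *v y) = 0" by simp
    then have "(M *v y) \<bullet> (W 1 1 *v (M *v y)) = 0"
      by (simp add: matrix_vector_mul_assoc[symmetric] inner_adj)
    then have "M *v y = 0" using pd[of "M *v y"] by force
    then have "N *v (M *v y) = 0" by simp
    then show ?thesis by (simp add: matrix_vector_mul_assoc M y_def)
  qed
  then have P1: "?P = mat 1" by (intro matrix_eqI) simp
  have NM: "adj N ** adj M = mat 1" using M(1) by (metis adj_mult adj_mat1)
  have "adj N ** (?P ** adj M) = W 1 1 ** M ** adj M"
    using NM by (simp add: matrix_mul_assoc)
  then have WR: "W 1 1 ** M ** adj M = mat 1" by (simp add: P1 NM)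
  then have RW: "M ** adj M ** W 1 1 = mat 1"
    by (metis matrix_left_right_inverse matrix_mul_assoc)
  define K where "K i = W i 1 ** M" for i
  have adjK: "adj (K i) = adj M ** W 1 i" for i by (simp add: K_def adj_mult adjW)
  define V where "V i j = W i j - K i ** adj (K j)" for i j
  have V1: "V i 1 = 0" for i
  proof -
    have "K i ** adj (K 1) = W i 1 ** (M ** adj M ** W 1 1)" by (simp only: adjK) (simp add: K_def matrix_mul_assoc)
    then show ?thesis by (simp add: V_def RW)
  qed
  have adjV: "adj (V i j) = V j i" for i j by (simp add: V_def adj_diff adj_mult adjW)
  have V1': "V 1 i = 0" for i using V1[of i] adjV[of i 1] by simp
  have "block_pos (V 2 2, V 2 3, V 3 3)"
    unfolding block_pos_def
  proof (intro conjI allI)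
    show "hermitian (fst (V 2 2, V 2 3, V 3 3))" "hermitian (snd (snd (V 2 2, V 2 3, V 3 3)))"
      by (simp_all add: hermitian_iff_adj adjV)
    fix a b :: complex and f :: "complex^3"
    define s where "s = W 1 2 *v (a *s f) + W 1 3 *v (b *s f)"
    define g where "g = - (M *v (adj M *v s))"
    define w where "w = (\<lambda>i::3. if i = 1 then g else if i = 2 then a *s f else b *s f)"
    define e where "e = (\<lambda>i::3. if i = 1 then 0 else if i = 2 then a else b)"
    define e' where "e' = (\<lambda>i::3. if i = 1 then 1 else 0 :: complex)"
    have w: "w i = e i *s f + e' i *s g" for i by (simp add: w_def e_def e'_def)
    have "0 \<le> (\<Sum>i\<in>UNIV. \<Sum>j\<in>UNIV. w i \<bullet> (W i j *v w j))"
      unfolding w using W by (simp add: two_block_pos_def)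
    also have "\<dots> = (\<Sum>i\<in>UNIV. \<Sum>j\<in>UNIV. w i \<bullet> (V i j *v w j)) + (\<Sum>i\<in>UNIV. \<Sum>j\<in>UNIV. (adj (K i) *v w i) \<bullet> (adj (K j) *v w j))"
      by (simp add: V_def matrix_vector_mult_diff_rdistrib inner_diff_right matrix_vector_mul_assoc[symmetric]
          inner_adj sum_subtractf)
    also have "(\<Sum>i\<in>UNIV. \<Sum>j\<in>UNIV. (adj (K i) *v w i) \<bullet> (adj (K j) *v w j))
        = (\<Sum>i\<in>UNIV. adj (K i) *v w i) \<bullet> (\<Sum>i\<in>UNIV. adj (K i) *v w i)"
      by (simp only: inner_sum_left) (simp only: inner_sum_right)
    also have "(\<Sum>i\<in>UNIV. adj (K i) *v w i) = 0"
    proof -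
      have "adj (K 1) *v g = - (adj M *v ((W 1 1 ** M ** adj M) *v s))"
        by (simp add: g_def adjK matrix_vec_minus matrix_vector_mul_assoc[symmetric])
      also have "\<dots> = - (adj M *v s)" by (simp add: WR)
      finally show ?thesis
        by (simp add: sum_3 w_def adjK s_def matrix_vector_right_distrib matrix_vector_mul_assoc)
    qed
    also have "(\<Sum>i\<in>UNIV. \<Sum>j\<in>UNIV. w i \<bullet> (V i j *v w j)) = (a *s f, b *s f) \<bullet> bop (V 2 2, V 2 3, V 3 3) (a *s f, b *s f)"
      by (simp add: sum_3 V1 V1' adjV w_def inner_add_right)
    finally show "0 \<le> (a *s f, b *s f) \<bullet> bop (V 2 2, V 2 3, V 3 3) (a *s f, b *s f)" by simp
  qed
  then have V: "0 \<le> pairing (V 2 2, V 2 3, V 3 3) (C 2 2, C 2 3, C 3 3)"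
    using C(2) by (rule pairing_nonneg)
  have "Re (\<Sum>i\<in>UNIV. \<Sum>j\<in>UNIV. trace (C i j ** V j i)) = pairing (V 2 2, V 2 3, V 3 3) (C 2 2, C 2 3, C 3 3)"
    by (simp add: sum_3 V1 V1' pairing_def adjV C(1) trace_def[of 0])
  with V have 1: "0 \<le> Re (\<Sum>i\<in>UNIV. \<Sum>j\<in>UNIV. trace (C i j ** V j i))" by simp
  have "Re (\<Sum>i\<in>UNIV. \<Sum>j\<in>UNIV. trace (C i j ** (K j ** adj (K i))))
      = (\<Sum>i\<in>UNIV. \<Sum>j\<in>UNIV. \<Sum>k\<in>UNIV. column k (K i) \<bullet> (C i j *v column k (K j)))"
    by (simp add: matrix_mul_assoc trace_adj_mult Re_cip)
  also have "\<dots> = (\<Sum>k\<in>UNIV. \<Sum>i\<in>UNIV. \<Sum>j\<in>UNIV. column k (K i) \<bullet> (C i j *v column k (K j)))"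
    by (simp add: sum_3)
  also have "\<dots> \<ge> 0" by (intro sum_nonneg Cpos)
  finally have 2: "0 \<le> Re (\<Sum>i\<in>UNIV. \<Sum>j\<in>UNIV. trace (C i j ** (K j ** adj (K i))))" .
  have "trace (C i j ** W j i) = trace (C i j ** V j i) + trace (C i j ** (K j ** adj (K i)))" for i j
    by (simp add: V_def matrix_mul_diff trace_sub)
  then show ?thesis using 1 2 by (simp add: sum.distrib)
qed

lemma two_block_pos_pairing_nonneg:
  fixes W C :: "3 \<Rightarrow> 3 \<Rightarrow> complex^3^3"
  assumes W: "two_block_pos W"
    and Cpos: "\<And>w. 0 \<le> (\<Sum>i\<in>UNIV. \<Sum>j\<in>UNIV. w i \<bullet> (C i j *v w j))"
    and C: "adj (C 2 3) = C 3 2" "ppt (C 2 2, C 2 3, C 3 3)"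
  shows "0 \<le> Re (\<Sum>i\<in>UNIV. \<Sum>j\<in>UNIV. trace (C i j ** W j i))"
proof -
  define c where "c = Re (\<Sum>i\<in>UNIV. \<Sum>j\<in>UNIV. trace (C i j ** W j i))"
  define d where "d = Re (\<Sum>i\<in>UNIV. trace (C i i))"
  have "0 \<le> c + \<epsilon> * d" if "0 < \<epsilon>" for \<epsilon>
  proof -
    define V where "V i j = W i j + (if i = j then \<epsilon> *\<^sub>R mat 1 else 0)" for i j :: 3
    have Vv: "V i j *v u = W i j *v u + (if i = j then \<epsilon> *\<^sub>R u else 0)" for i j u
      by (simp add: V_def matrix_vector_mult_add_rdistrib scaleR_matrix_vec)
    have W1: "0 \<le> u \<bullet> (W 1 1 *v u)" for u
    proof -
      have "0 \<le> (\<Sum>i\<in>UNIV. \<Sum>j\<in>UNIV. (e i *s u + e' i *s u) \<bullet> (W i j *v (e j *s u + e' j *s u)))" for e e'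
        using W by (simp add: two_block_pos_def)
      from this[of "\<lambda>i. if i = 1 then 1 else 0" "\<lambda>_. 0"] show ?thesis by (simp add: sum_3)
    qed
    have "two_block_pos V"
      unfolding two_block_pos_def
    proof (intro conjI allI)
      show "adj (V i j) = V j i" for i j
        using W by (auto simp: V_def two_block_pos_def adj_add adj_scaleR)
      fix e e' :: "3 \<Rightarrow> complex" and f g :: "complex^3"
      let ?w = "\<lambda>i. e i *s f + e' i *s g"
      have "0 \<le> (\<Sum>i\<in>UNIV. \<Sum>j\<in>UNIV. ?w i \<bullet> (W i j *v ?w j))" using W by (simp add: two_block_pos_def)
      moreover have "0 \<le> (\<Sum>i\<in>UNIV. \<epsilon> * (?w i \<bullet> ?w i))" using that by (intro sum_nonneg) simp
      moreover have "(\<Sum>i\<in>UNIV. \<Sum>j\<in>UNIV. ?w i \<bullet> (V i j *v ?w j))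
          = (\<Sum>i\<in>UNIV. \<Sum>j\<in>UNIV. ?w i \<bullet> (W i j *v ?w j)) + (\<Sum>i\<in>UNIV. \<epsilon> * (?w i \<bullet> ?w i))"
        by (simp only: Vv inner_add_right[of _ "W _ _ *v _"] sum.distrib) (simp add: if_distrib[of "(\<bullet>) _"] cong: if_cong)
      ultimately show "0 \<le> (\<Sum>i\<in>UNIV. \<Sum>j\<in>UNIV. ?w i \<bullet> (V i j *v ?w j))" by simp
    qed
    moreover have "0 < u \<bullet> (V 1 1 *v u)" if "u \<noteq> 0" for u
      using W1[of u] that \<open>0 < \<epsilon>\<close> by (simp add: Vv inner_add_right add_nonneg_pos)
    ultimately have "0 \<le> Re (\<Sum>i\<in>UNIV. \<Sum>j\<in>UNIV. trace (C i j ** V j i))"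
      using Cpos C by (rule two_block_pos_pairing_definite)
    also have "\<dots> = c + \<epsilon> * d"
    proof -
      have "trace (C i j ** V j i) = trace (C i j ** W j i) + (if j = i then complex_of_real \<epsilon> * trace (C i i) else 0)" for i j
        by (cases "j = i")
           (simp_all add: V_def matrix_add_ldistrib trace_add matrix_mul_scaleR trace_scaleR,
            simp add: scaleR_conv_of_real)
      then show ?thesis by (simp add: sum.distrib c_def d_def sum_distrib_left)
    qed
    finally show ?thesis .
  qed
  note le = this
  have "0 \<le> c"
  proof (rule ccontr)
    assume "\<not> 0 \<le> c"
    define \<epsilon> where "\<epsilon> = - c / (2 * (\<bar>d\<bar> + 1))"
    have \<epsilon>: "0 < \<epsilon>" "\<epsilon> * (\<bar>d\<bar> + 1) = - c / 2"
      using \<open>\<not> 0 \<le> c\<close> by (simp_all add: \<epsilon>_def field_simps)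
    have "\<epsilon> * d \<le> \<epsilon> * (\<bar>d\<bar> + 1)" using \<epsilon>(1) by (intro mult_left_mono) auto
    with le[OF \<epsilon>(1)] \<epsilon>(2) \<open>\<not> 0 \<le> c\<close> show False by simp
  qed
  then show ?thesis by (simp add: c_def)
qed

subsection \<open>Completely positive maps\<close>

lemma PSD_iff: "A \<in> PSD \<longleftrightarrow> psd_matrix A"
proof -
  have form: "Re (\<Sum>i\<in>UNIV. \<Sum>j\<in>UNIV. cnj (v i) * A $ i $ j * v j) = (\<chi> i. v i) \<bullet> (A *v (\<chi> i. v i))" for v
    by (simp add: Re_cip[symmetric] cip_def matrix_vector_mult_def sum_distrib_left mult.assoc)
  have "psd_matrix A \<longleftrightarrow> hermitian A \<and> (\<forall>v. 0 \<le> (\<chi> i. v i) \<bullet> (A *v (\<chi> i. v i)))"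
    unfolding psd_matrix_def by (metis vec_nth_inverse)
  then show ?thesis
    by (simp only: PSD_def psd_on_def mem_Collect_eq form) (simp add: hermitian_iff_adj vec_eq_iff)
qed

lemma psd_on_rank_one: "psd_on I (\<lambda>p q. f p * cnj (f q))"
proof -
  have "(\<Sum>p\<in>I. \<Sum>q\<in>I. cnj (v p) * (f p * cnj (f q)) * v q) = (\<Sum>p\<in>I. cnj (v p) * f p) * cnj (\<Sum>p\<in>I. cnj (v p) * f p)" for v
    by (simp add: sum_product mult_ac)
  then show ?thesis
    by (simp only: psd_on_def complex_norm_square[symmetric]) (simp add: mult.commute)
qed

lemma completely_positive_outer:
  assumes "completely_positive T"
  shows "0 \<le> (\<Sum>k<n::nat. \<Sum>l<n. w k \<bullet> (T (outer (u k) (u l)) *v w l))"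
    and "adj (T (outer x y)) = T (outer y x)"
proof -
  have cp: "psd_on ({..<n} \<times> UNIV) (\<lambda>(i, a) (j, b). T (outer (u i) (u j)) $ a $ b)" for n :: nat and u
  proof -
    have "(\<lambda>(i, a) (j, b). outer (u i) (u j) $ a $ b) = (\<lambda>p q. (\<lambda>(i, a). u i $ a) p * cnj ((\<lambda>(i, a). u i $ a) q))"
      by (auto simp: fun_eq_iff)
    then have "psd_on ({..<n} \<times> UNIV) (\<lambda>(i, a) (j, b). outer (u i) (u j) $ a $ b)"
      by (simp only: psd_on_rank_one)
    then show ?thesis
      by (rule assms[unfolded completely_positive_def, rule_format, of n "\<lambda>i j. outer (u i) (u j)"])
  qed
  have "0 \<le> Re (\<Sum>p\<in>{..<n} \<times> UNIV. \<Sum>q\<in>{..<n} \<times> UNIV.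
      cnj ((\<lambda>(k, a). w k $ a) p) * (\<lambda>(i, a) (j, b). T (outer (u i) (u j)) $ a $ b) p q * (\<lambda>(k, a). w k $ a) q)"
    using cp[of n u] unfolding psd_on_def by blast
  also have "(\<Sum>p\<in>{..<n} \<times> UNIV. \<Sum>q\<in>{..<n} \<times> UNIV.
      cnj ((\<lambda>(k, a). w k $ a) p) * (\<lambda>(i, a) (j, b). T (outer (u i) (u j)) $ a $ b) p q * (\<lambda>(k, a). w k $ a) q)
    = (\<Sum>k<n. \<Sum>a\<in>UNIV. \<Sum>l<n. \<Sum>b\<in>UNIV. cnj (w k $ a) * T (outer (u k) (u l)) $ a $ b * w l $ b)"
    by (simp add: sum.cartesian_product' )
  also have "\<dots> = (\<Sum>k<n. \<Sum>l<n. \<Sum>a\<in>UNIV. \<Sum>b\<in>UNIV. cnj (w k $ a) * T (outer (u k) (u l)) $ a $ b * w l $ b)"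
    by (intro sum.cong refl sum.swap)
  also have "\<dots> = (\<Sum>k<n. \<Sum>l<n. cip (w k) (T (outer (u k) (u l)) *v w l))"
    by (simp add: cip_def matrix_vector_mult_def sum_distrib_left mult.assoc)
  finally show "0 \<le> (\<Sum>k<n. \<Sum>l<n. w k \<bullet> (T (outer (u k) (u l)) *v w l))"
    by (simp add: Re_cip)
  define v where "v = (\<lambda>k::nat. if k = 0 then y else x)"
  have "cnj (T (outer (v 1) (v 0)) $ b $ a) = T (outer (v 0) (v 1)) $ a $ b" for a b
  proof -
    have "(0::nat, a) \<in> {..<2} \<times> UNIV" "(1::nat, b) \<in> {..<2} \<times> UNIV" by auto
    then show ?thesis using cp[of 2 v] unfolding psd_on_def by fastforce
  qed
  then show "adj (T (outer x y)) = T (outer y x)" by (simp add: vec_eq_iff v_def)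
qed

definition vcnj :: "complex^'n \<Rightarrow> complex^'n" where
  "vcnj v = (\<chi> i. cnj (v $ i))"

lemma vcnj_nth [simp]: "vcnj v $ i = cnj (v $ i)" by (simp add: vcnj_def)

lemma completely_positive_transpose_outer:
  fixes T :: "complex^'m^'m \<Rightarrow> complex^'n^'n"
  assumes T: "completely_positive T" and "completely_positive (transpose \<circ> T)"
  shows "0 \<le> (\<Sum>k<n::nat. \<Sum>l<n. w k \<bullet> (T (outer (u l) (u k)) *v w l))"
proof -
  have vt: "vcnj x \<bullet> (transpose M *v vcnj y) = x \<bullet> (adj M *v y)" for x y :: "complex^'n" and M
  proof -
    have "transpose M *v vcnj y = vcnj (adj M *v y)"
      by (simp add: vec_eq_iff matrix_vector_mult_def transpose_def)
    then show ?thesis by (simp add: inner_vec_def inner_complex_def)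
  qed
  have "w k \<bullet> (T (outer (u l) (u k)) *v w l) = vcnj (w k) \<bullet> ((transpose \<circ> T) (outer (u k) (u l)) *v vcnj (w l))" for k l
    by (simp only: o_apply vt completely_positive_outer(2)[OF T])
  then show ?thesis
    using completely_positive_outer(1)[OF assms(2), where w = "\<lambda>k. vcnj (w k)"] by (simp only:)
qed

lemma mat_unit_outer: "mat_unit i j = outer (axis i 1) (axis j 1)"
  by (auto simp: vec_eq_iff mat_unit_def axis_def)

lemma adj_cscale: "adj (cscale c A) = cscale (cnj c) (adj A)"
  by (simp add: vec_eq_iff)

lemma adj_sum: "adj (sum F I) = (\<Sum>i\<in>I. adj (F i))"
  using linear_sum[OF linear_adj] by blast

lemma completely_positive_ppt_map:
  fixes T :: "complex^'m^'m \<Rightarrow> complex^'n^'n"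
  assumes lin: "complex_linear T" and T: "completely_positive T" and T': "completely_positive (transpose \<circ> T)"
  shows "ppt_map T"
  unfolding ppt_map_def
proof (intro conjI allI)
  note adjT = completely_positive_outer(2)[OF T]
  show "T (adj A) = adj (T A)" for A
  proof -
    have "adj (T A) = (\<Sum>i\<in>UNIV. \<Sum>j\<in>UNIV. cscale (cnj (A $ i $ j)) (T (mat_unit j i)))"
      by (subst complex_linear_expansion[OF lin]) (simp add: adj_sum adj_cscale mat_unit_outer adjT)
    also have "\<dots> = (\<Sum>j\<in>UNIV. \<Sum>i\<in>UNIV. cscale (cnj (A $ i $ j)) (T (mat_unit j i)))" by (rule sum.swap)
    also have "\<dots> = T (adj A)" by (subst complex_linear_expansion[OF lin, of "adj A"]) simp
    finally show ?thesis by simp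
  qed
  fix u v :: "complex^'m"
  define p where "p = (\<lambda>k::nat. if k = 0 then u else v)"
  have "0 \<le> x \<bullet> bop (T (outer u u), T (outer u v), T (outer v v)) x" for x :: "(complex^'n) \<times> (complex^'n)"
  proof -
    define w where "w = (\<lambda>k::nat. if k = 0 then fst x else snd x)"
    have "0 \<le> (\<Sum>k<2. \<Sum>l<2. w k \<bullet> (T (outer (p k) (p l)) *v w l))" by (rule completely_positive_outer[OF T])
    then show ?thesis
      by (cases x) (simp add: numeral_2_eq_2 w_def p_def adjT inner_add_right)
  qed
  moreover have "0 \<le> x \<bullet> bop (T (outer u u), T (outer v u), T (outer v v)) x" for x :: "(complex^'n) \<times> (complex^'n)"
  proof -
    define w where "w = (\<lambda>k::nat. if k = 0 then fst x else snd x)"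
    have "0 \<le> (\<Sum>k<2. \<Sum>l<2. w k \<bullet> (T (outer (p l) (p k)) *v w l))"
      by (rule completely_positive_transpose_outer[OF T T'])
    then show ?thesis
      by (cases x) (simp add: numeral_2_eq_2 w_def p_def adjT inner_add_right)
  qed
  ultimately show "ppt (T (outer u u), T (outer u v), T (outer v v))"
    by (simp add: ppt_def block_psd_def hermitian_iff_adj adjT del: split_paired_All)
qed (rule lin)

subsection \<open>Pairing with the maximal tensor product\<close>

lemma sum_UNIV_prod: "(\<Sum>p\<in>UNIV. F p) = (\<Sum>a\<in>UNIV. \<Sum>b\<in>UNIV. F (a, b))"
  by (simp add: sum.cartesian_product UNIV_Times_UNIV[symmetric] del: UNIV_Times_UNIV)

definition block :: "complex^('a::finite \<times> 'b::finite)^('a \<times> 'b) \<Rightarrow> 'a \<Rightarrow> 'a \<Rightarrow> complex^'b^'b" where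
  "block z a b = (\<chi> k l. z $ (a, k) $ (b, l))"

definition compress :: "complex^('a::finite \<times> 'b::finite)^('a \<times> 'b) \<Rightarrow> complex^'a \<Rightarrow> complex^'a \<Rightarrow> complex^'b^'b" where
  "compress z f g = (\<Sum>a\<in>UNIV. \<Sum>b\<in>UNIV. cscale (cnj (f $ a) * g $ b) (block z a b))"

lemma block_nth [simp]: "block z a b $ k $ l = z $ (a, k) $ (b, l)" by (simp add: block_def)

lemma adj_block: "hermitian z \<Longrightarrow> adj (block z a b) = block z b a"
  by (simp add: hermitian_iff_adj vec_eq_iff)

lemma adj_compress:
  assumes "hermitian z" shows "adj (compress z f g) = compress z g f"
proof -
  have "adj (compress z f g) = (\<Sum>a\<in>UNIV. \<Sum>b\<in>UNIV. cscale (cnj (g $ b) * f $ a) (block z b a))"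
    by (simp add: compress_def adj_sum adj_cscale adj_block[OF assms] mult.commute)
  then show ?thesis unfolding compress_def by (subst sum.swap)
qed

lemma cip_compress:
  fixes z :: "complex^('a::finite \<times> 'b::finite)^('a \<times> 'b)"
  shows "cip h (compress z f g *v h') =
  (\<Sum>a\<in>UNIV. \<Sum>b\<in>UNIV. cnj (f $ a) * g $ b * cip h (block z a b *v h'))"
proof -
  have sum_vec: "sum F I *v v = (\<Sum>i\<in>I. F i *v v)" for F :: "'c \<Rightarrow> complex^'b^'b" and I and v
    by (induction I rule: infinite_finite_induct) (simp_all add: matrix_vector_mult_add_rdistrib)
  have cip_sum: "cip h (sum F I) = (\<Sum>i\<in>I. cip h (F i))" for F :: "'c \<Rightarrow> complex^'b" and I
    by (induction I rule: infinite_finite_induct) (simp_all add: cip_simps)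
  have "cscale c A *v h' = c *s (A *v h')" for c and A :: "complex^'b^'b"
    by (simp add: vec_eq_iff matrix_vector_mult_def sum_distrib_left mult.assoc)
  then show ?thesis by (simp add: compress_def sum_vec cip_sum cip_simps)
qed

lemma PSD_max_tensorD:
  assumes "z \<in> PSD_max_tensor"
  shows "hermitian z" "0 \<le> h \<bullet> (compress z k k *v h)"
proof -
  show "hermitian z" using assms by (simp add: PSD_max_tensor_def dual_cone_def)
  have "outer k k \<in> PSD" "outer h h \<in> PSD" by (simp_all add: PSD_iff psd_matrix_outer)
  then have "kron (outer k k) (outer h h) \<in> min_tensor PSD PSD"
    unfolding min_tensor_def by (intro hull_inc) blast
  then have "0 \<le> Re (trace (z ** kron (outer k k) (outer h h)))"
    using assms by (simp add: PSD_max_tensor_def dual_cone_def)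
  also have "trace (z ** kron (outer k k) (outer h h)) =
      (\<Sum>a\<in>UNIV. \<Sum>l\<in>UNIV. \<Sum>b\<in>UNIV. \<Sum>m\<in>UNIV. cnj (k $ a) * k $ b * (cnj (h $ l) * z $ (a, l) $ (b, m) * h $ m))"
    by (simp add: trace_def matrix_matrix_mult_def sum_UNIV_prod mult_ac)
  also have "\<dots> = (\<Sum>a\<in>UNIV. \<Sum>b\<in>UNIV. \<Sum>l\<in>UNIV. \<Sum>m\<in>UNIV. cnj (k $ a) * k $ b * (cnj (h $ l) * z $ (a, l) $ (b, m) * h $ m))"
    by (intro sum.cong refl sum.swap)
  also have "\<dots> = cip h (compress z k k *v h)"
    unfolding cip_compress by (simp add: cip_def matrix_vector_mult_def sum_distrib_left mult.assoc)
  finally show "0 \<le> h \<bullet> (compress z k k *v h)" by (simp add: Re_cip)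
qed

lemma block_pos_compress:
  assumes z: "z \<in> PSD_max_tensor"
  shows "block_pos (compress z f f, compress z f g, compress z g g)"
  unfolding block_pos_def
proof (intro conjI allI)
  note adj = adj_compress[OF PSD_max_tensorD(1)[OF z]]
  show "hermitian (fst (compress z f f, compress z f g, compress z g g))"
    "hermitian (snd (snd (compress z f f, compress z f g, compress z g g)))"
    by (simp_all add: hermitian_iff_adj adj)
  fix a b h
  have "0 \<le> Re (cip h (compress z (a *s f + b *s g) (a *s f + b *s g) *v h))"
    using PSD_max_tensorD(2)[OF z] by (simp add: Re_cip)
  also have "cip h (compress z (a *s f + b *s g) (a *s f + b *s g) *v h)
    = cip (a *s h) (compress z f f *v (a *s h)) + cip (a *s h) (compress z f g *v (b *s h))
    + (cip (b *s h) (compress z g f *v (a *s h)) + cip (b *s h) (compress z g g *v (b *s h)))"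
    by (simp add: cip_scale_left vector_scalar_commute cip_scale_right cip_compress)
       (simp add: algebra_simps sum.distrib sum_distrib_left)
  finally show "0 \<le> (a *s h, b *s h) \<bullet>
      bop (compress z f f, compress z f g, compress z g g) (a *s h, b *s h)"
    by (simp add: adj Re_cip inner_add_right)
qed

text \<open>For fixed \<open>S\<close>, \<open>x\<close> and \<open>z\<close> the pairing of \<open>(T \<otimes> S)(x)\<close> with \<open>z\<close> is the pairing of the
  Choi matrix of \<open>T\<close> with the array \<open>choi_functional S x z\<close>.\<close>

definition choi_functional ::
  "(complex^'b^'b \<Rightarrow> complex^'d^'d) \<Rightarrow> complex^('a::finite \<times> 'b::finite)^('a \<times> 'b) \<Rightarrow>
   complex^('c::finite \<times> 'd::finite)^('c \<times> 'd) \<Rightarrow>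
   'a \<Rightarrow> 'a \<Rightarrow> complex^'c^'c" where
  "choi_functional S x z i j = (\<chi> a b. trace (S (block x j i) ** block z a b))"

lemma tensor_map_nth:
  assumes "complex_linear S"
  shows "tensor_map T S x $ (a, b) $ (c, d) =
    (\<Sum>i\<in>UNIV. \<Sum>j\<in>UNIV. T (mat_unit i j) $ a $ c * S (block x i j) $ b $ d)"
proof -
  have "S (block x i j) = (\<Sum>k\<in>UNIV. \<Sum>l\<in>UNIV. cscale (x $ (i, k) $ (j, l)) (S (mat_unit k l)))" for i j
    by (subst complex_linear_expansion[OF assms]) simp
  then show ?thesis by (simp add: tensor_map_def sum_distrib_left mult_ac)
qed

lemma trace_tensor_map:
  fixes T :: "complex^'a^'a \<Rightarrow> complex^'c^'c" and S :: "complex^'b^'b \<Rightarrow> complex^'d^'d"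
  assumes "complex_linear S"
  shows "trace (tensor_map T S x ** z) =
    (\<Sum>i\<in>UNIV. \<Sum>j\<in>UNIV. trace (T (mat_unit i j) ** choi_functional S x z j i))"
proof -
  note t = tensor_map_nth[OF assms]
  have "trace (tensor_map T S x ** z) = (\<Sum>a\<in>UNIV. \<Sum>b\<in>UNIV. \<Sum>c\<in>UNIV. \<Sum>d\<in>UNIV. \<Sum>i\<in>UNIV. \<Sum>j\<in>UNIV.
      T (mat_unit i j) $ a $ c * S (block x i j) $ b $ d * z $ (c, d) $ (a, b))"
    by (simp add: trace_def matrix_matrix_mult_def sum_UNIV_prod t sum_distrib_right)
  also have "\<dots> = (\<Sum>i\<in>UNIV. \<Sum>j\<in>UNIV. \<Sum>a\<in>UNIV. \<Sum>c\<in>UNIV. \<Sum>b\<in>UNIV. \<Sum>d\<in>UNIV.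
      T (mat_unit i j) $ a $ c * S (block x i j) $ b $ d * z $ (c, d) $ (a, b))"
  proof -
    have "(\<Sum>a\<in>UNIV. \<Sum>b\<in>UNIV. \<Sum>c\<in>UNIV. \<Sum>d\<in>UNIV. \<Sum>i\<in>UNIV. \<Sum>j\<in>UNIV. F a b c d i j)
        = (\<Sum>((a, b, c, d), (i, j))\<in>UNIV. F a b c d i j)"
      for F :: "'c \<Rightarrow> 'd \<Rightarrow> 'c \<Rightarrow> 'd \<Rightarrow> 'a \<Rightarrow> 'a \<Rightarrow> complex"
      by (simp add: sum_UNIV_prod)
    moreover have "(\<Sum>((a, b, c, d), (i, j))\<in>UNIV. F a b c d i j) = (\<Sum>i\<in>UNIV. \<Sum>j\<in>UNIV. \<Sum>a\<in>UNIV. \<Sum>c\<in>UNIV. \<Sum>b\<in>UNIV. \<Sum>d\<in>UNIV. F a b c d i j)"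
      for F :: "'c \<Rightarrow> 'd \<Rightarrow> 'c \<Rightarrow> 'd \<Rightarrow> 'a \<Rightarrow> 'a \<Rightarrow> complex"
    proof -
      have "(\<Sum>((a, b, c, d), (i, j))\<in>UNIV. F a b c d i j) = (\<Sum>(i, j, a, c, b, d)\<in>UNIV. F a b c d i j)"
        by (rule sum.reindex_bij_witness[of _ "\<lambda>(i, j, a, c, b, d). ((a, b, c, d), (i, j))" "\<lambda>((a, b, c, d), (i, j)). (i, j, a, c, b, d)"]) auto
      then show ?thesis by (simp add: sum_UNIV_prod)
    qed
    ultimately show ?thesis by simp
  qed
  also have "\<dots> = (\<Sum>i\<in>UNIV. \<Sum>j\<in>UNIV. trace (T (mat_unit i j) ** choi_functional S x z j i))"
    by (simp add: trace_def matrix_matrix_mult_def choi_functional_def sum_distrib_left mult.assoc)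
  finally show ?thesis .
qed

lemma two_block_pos_choi_functional:
  fixes S :: "complex^3^3 \<Rightarrow> complex^3^3" and x z :: "complex^(3 \<times> 3)^(3 \<times> 3)"
  assumes S: "ppt_map S" and x: "x \<in> PSD_max_tensor" and z: "z \<in> PSD_max_tensor"
  shows "two_block_pos (choi_functional S x z)"
  unfolding two_block_pos_def
proof (intro conjI allI)
  let ?W = "choi_functional S x z"
  have lin: "complex_linear S" and herm: "S (adj A) = adj (S A)" for A using S by (auto simp: ppt_map_def)
  have hx: "hermitian x" and hz: "hermitian z" using PSD_max_tensorD(1) x z by auto
  show "adj (?W i j) = ?W j i" for i j
  proof -
    have "cnj (trace (S (block x j i) ** block z b a)) = trace (S (block x i j) ** block z a b)" for a b
    proof -
      have "cnj (trace (S (block x j i) ** block z b a)) = trace (adj (block z b a) ** adj (S (block x j i)))"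
        by (simp add: trace_adj[symmetric] adj_mult)
      also have "\<dots> = trace (block z a b ** S (block x i j))"
        by (simp add: herm[symmetric] adj_block hx hz)
      finally show ?thesis by (simp add: trace_cyclic[of "block z a b"])
    qed
    then show ?thesis by (simp add: vec_eq_iff choi_functional_def)
  qed
  fix e e' :: "3 \<Rightarrow> complex" and f g :: "complex^3"
  define E where "E p = (\<chi> i. cnj (p i))" for p :: "3 \<Rightarrow> complex"
  have trl: "trace (S (compress x F G) ** Z) = (\<Sum>a\<in>UNIV. \<Sum>b\<in>UNIV. cnj (F $ a) * G $ b * trace (S (block x a b) ** Z))" for F G Z
    by (simp add: compress_def complex_linear_sum[OF lin] complex_linear_cscale[OF lin] trace_sum_left trace_cscale)
  have trr: "trace (Y ** compress z F G) = (\<Sum>a\<in>UNIV. \<Sum>b\<in>UNIV. cnj (F $ a) * G $ b * trace (Y ** block z a b))" for F G Y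
    by (simp add: trace_cyclic[of Y] compress_def trace_sum_left trace_cscale)
  have W: "cip F (?W i j *v G) = trace (S (block x j i) ** compress z F G)" for F G i j
    by (simp add: trr cip_def matrix_vector_mult_def choi_functional_def sum_distrib_left mult_ac)
  have sum: "(\<Sum>i\<in>UNIV. \<Sum>j\<in>UNIV. cnj (p i) * q j * cip F (?W i j *v G))
      = trace (S (compress x (E q) (E p)) ** compress z F G)" for p q F G
    unfolding W trl E_def by (subst sum.swap) (simp add: mult_ac)
  have adjx: "adj (S (compress x F G)) = S (compress x G F)" for F G
    by (simp add: herm[symmetric] adj_compress[OF hx])
  have "0 \<le> pairing (compress z f f, compress z f g, compress z g g)
      (S (compress x (E e) (E e)), S (compress x (E e) (E e')), S (compress x (E e') (E e')))"
    by (intro ppt_map_pairing_nonneg[OF S] block_pos_compress x z)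
  also have "\<dots> = Re (\<Sum>i\<in>UNIV. \<Sum>j\<in>UNIV. cip (e i *s f + e' i *s g) (?W i j *v (e j *s f + e' j *s g)))"
    by (simp add: pairing_def adjx adj_compress[OF hz] sum[symmetric] cip_simps matrix_vector_right_distrib
        vector_scalar_commute ring_distribs sum.distrib mult_ac)
  finally show "0 \<le> (\<Sum>i\<in>UNIV. \<Sum>j\<in>UNIV. (e i *s f + e' i *s g) \<bullet> (?W i j *v (e j *s f + e' j *s g)))"
    by (simp add: Re_cip)
qed

lemma tensor_map_pairing_nonneg:
  fixes T S :: "complex^3^3 \<Rightarrow> complex^3^3"
  assumes T: "complex_linear T" "completely_positive T" "completely_positive (transpose \<circ> T)"
    and S: "ppt_map S" and x: "x \<in> PSD_max_tensor" and z: "z \<in> PSD_max_tensor"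
  shows "0 \<le> Re (trace (tensor_map T S x ** z))"
proof -
  have lin: "complex_linear S" using S by (simp add: ppt_map_def)
  define C where "C i j = T (mat_unit i j)" for i j
  have "0 \<le> (\<Sum>i\<in>UNIV. \<Sum>j\<in>UNIV. w i \<bullet> (C i j *v w j))" for w
  proof -
    define i where "i = (\<lambda>k::nat. if k = 0 then 1 else if k = 1 then 2 else 3 :: 3)"
    have "0 \<le> (\<Sum>k<3. \<Sum>l<3. w (i k) \<bullet> (T (outer (axis (i k) 1) (axis (i l) 1)) *v w (i l)))"
      by (rule completely_positive_outer(1)[OF T(2)])
    then show ?thesis by (simp add: C_def mat_unit_outer sum_3 numeral_3_eq_3 i_def)
  qed
  moreover have "adj (C 2 3) = C 3 2"
    by (simp add: C_def mat_unit_outer completely_positive_outer(2)[OF T(2)])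
  moreover have "ppt (C 2 2, C 2 3, C 3 3)"
    using completely_positive_ppt_map[OF T] by (simp add: ppt_map_def C_def mat_unit_outer)
  ultimately have "0 \<le> Re (\<Sum>i\<in>UNIV. \<Sum>j\<in>UNIV. trace (C i j ** choi_functional S x z j i))"
    by (rule two_block_pos_pairing_nonneg[OF two_block_pos_choi_functional[OF S x z]])
  then show ?thesis by (simp add: trace_tensor_map[OF lin] C_def)
qed

subsection \<open>The minimal tensor product is closed\<close>

lemma closed_psd_matrix: "closed {A :: complex^'n^'n. psd_matrix A}"
proof -
  have c: "continuous_on UNIV (\<lambda>A :: complex^'n^'n. A *v u)" for u
  proof -
    have "linear (\<lambda>A :: complex^'n^'n. A *v u)"
      by (rule linearI) (simp_all add: matrix_vector_mult_add_rdistrib scaleR_matrix_vec)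
    then show ?thesis by (simp add: linear_continuous_on linear_conv_bounded_linear[symmetric])
  qed
  have a: "continuous_on UNIV (adj :: complex^'n^'n \<Rightarrow> _)"
    by (simp add: linear_adj linear_continuous_on linear_conv_bounded_linear[symmetric])
  show ?thesis
    unfolding psd_matrix_def hermitian_iff_adj
    by (intro closed_Collect_conj closed_Collect_all closed_Collect_eq closed_Collect_le
        continuous_intros c a)
qed

lemma psd_matrix_scaleR: "psd_matrix A \<Longrightarrow> 0 \<le> r \<Longrightarrow> psd_matrix (r *\<^sub>R A)"
  by (simp add: psd_matrix_def hermitian_iff_adj adj_scaleR scaleR_matrix_vec)

lemma psd_matrix_trace_pos: "psd_matrix A \<Longrightarrow> A \<noteq> 0 \<Longrightarrow> 0 < Re (trace A)"
  using psd_matrix_trace_nonneg[of A] psd_matrix_trace_zero[of A] by fastforce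

lemma kron_scaleR: "kron (r *\<^sub>R A) B = r *\<^sub>R kron A B" "kron A (r *\<^sub>R B) = r *\<^sub>R kron A B"
  by (simp_all add: vec_eq_iff kron_def)

lemma trace_kron: "trace (kron A B) = trace A * trace B"
  by (simp add: trace_def sum_UNIV_prod sum_product)

lemma adj_kron: "adj (kron A B) = kron (adj A) (adj B)"
  by (simp add: vec_eq_iff kron_def)

lemma psd_trace_real: "psd_matrix A \<Longrightarrow> Im (trace A) = 0"
  using trace_adj[of A] by (simp add: psd_matrix_def hermitian_iff_adj complex_eq_iff)

definition unit_products :: "(complex^('a::finite \<times> 'b::finite)^('a \<times> 'b)) set" where
  "unit_products = (\<lambda>(x, y). kron x y) `
     (({x. psd_matrix x} \<inter> sphere 0 1) \<times> ({y. psd_matrix y} \<inter> sphere 0 1))"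

lemma compact_unit_products: "compact (unit_products :: (complex^('a::finite \<times> 'b::finite)^('a \<times> 'b)) set)"
  unfolding unit_products_def
proof (rule compact_continuous_image)
  show "continuous_on S (\<lambda>(x, y). kron x y)" for S :: "((complex^'a^'a) \<times> (complex^'b^'b)) set"
    unfolding kron_def case_prod_unfold by (intro continuous_intros)
  show "compact (({x :: complex^'a^'a. psd_matrix x} \<inter> sphere 0 1) \<times> ({y :: complex^'b^'b. psd_matrix y} \<inter> sphere 0 1))"
    by (intro compact_Times closed_Int_compact closed_psd_matrix compact_sphere)
qed

lemma kron_in_conic_hull:
  assumes "psd_matrix x" "psd_matrix y" "x \<noteq> 0" "y \<noteq> 0"
  shows "kron x y \<in> conic hull (convex hull unit_products)"
proof -
  have "kron (x /\<^sub>R norm x) (y /\<^sub>R norm y) \<in> unit_products"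
    using assms by (auto simp: unit_products_def psd_matrix_scaleR intro!: rev_image_eqI[of "(x /\<^sub>R norm x, y /\<^sub>R norm y)"])
  then have "kron (x /\<^sub>R norm x) (y /\<^sub>R norm y) \<in> convex hull unit_products" by (rule hull_inc)
  moreover have "kron x y = (norm x * norm y) *\<^sub>R kron (x /\<^sub>R norm x) (y /\<^sub>R norm y)"
    using assms by (simp add: kron_scaleR field_simps)
  ultimately show ?thesis using assms by (metis conicD conic_conic_hull hull_inc mult_nonneg_nonneg norm_ge_zero)
qed

lemma conic_hull_subset_min_tensor: "conic hull (convex hull unit_products) \<subseteq> min_tensor PSD PSD"
proof -
  let ?G = "{kron x y | x y. x \<in> PSD \<and> y \<in> PSD}"
  have "c *\<^sub>R h \<in> convex hull ?G" if c: "0 \<le> c" and h: "h \<in> convex hull unit_products" for c :: real and h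
  proof -
    have "unit_products \<subseteq> ?G" by (auto simp: unit_products_def PSD_iff)
    then have "c *\<^sub>R h \<in> (*\<^sub>R) c ` (convex hull ?G)" using h hull_mono by blast
    also have "\<dots> = convex hull ((*\<^sub>R) c ` ?G)" by (rule convex_hull_scaling[symmetric])
    also have "(*\<^sub>R) c ` ?G \<subseteq> ?G"
    proof
      fix w assume "w \<in> (*\<^sub>R) c ` ?G"
      then obtain x y where xy: "w = kron (c *\<^sub>R x) y" "x \<in> PSD" "y \<in> PSD" by (auto simp: kron_scaleR)
      then have "c *\<^sub>R x \<in> PSD" using c by (simp add: PSD_iff psd_matrix_scaleR)
      with xy show "w \<in> ?G" by blast
    qed
    then have "convex hull ((*\<^sub>R) c ` ?G) \<subseteq> convex hull ?G" by (rule hull_mono)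
    finally show ?thesis .
  qed
  then show ?thesis unfolding conic_hull_explicit min_tensor_def by blast
qed

lemma closed_conic_hull_unit_products:
  "closed (conic hull (convex hull (unit_products :: (complex^('a::finite \<times> 'b::finite)^('a \<times> 'b)) set)))"
proof (rule closed_conic_hull, intro disjI2 conjI)
  show "compact (convex hull (unit_products :: (complex^('a::finite \<times> 'b::finite)^('a \<times> 'b)) set))"
    by (intro compact_convex_hull compact_unit_products)
  have "convex {w :: complex^('a \<times> 'b)^('a \<times> 'b). 0 < Re (trace w)}"
  proof (rule convexI)
    fix x y :: "complex^('a \<times> 'b)^('a \<times> 'b)" and u v :: real
    assume "x \<in> {w. 0 < Re (trace w)}" "y \<in> {w. 0 < Re (trace w)}" "0 \<le> u" "0 \<le> v" "u + v = 1"
    then have "0 < u * Re (trace x) + v * Re (trace y)"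
      by (cases "u = 0") (auto intro: add_pos_nonneg)
    then show "u *\<^sub>R x + v *\<^sub>R y \<in> {w. 0 < Re (trace w)}" by (simp add: trace_add trace_scaleR)
  qed
  moreover have "unit_products \<subseteq> {w :: complex^('a \<times> 'b)^('a \<times> 'b). 0 < Re (trace w)}"
  proof
    fix w :: "complex^('a \<times> 'b)^('a \<times> 'b)" assume "w \<in> unit_products"
    then obtain x :: "complex^'a^'a" and y :: "complex^'b^'b"
      where *: "w = kron x y" "psd_matrix x" "psd_matrix y" "norm x = 1" "norm y = 1"
      by (auto simp: unit_products_def)
    then have "x \<noteq> 0" "y \<noteq> 0" by auto
    then have "0 < Re (trace x) * Re (trace y)" using * by (intro mult_pos_pos psd_matrix_trace_pos)
    then show "w \<in> {w. 0 < Re (trace w)}" using * by (simp add: trace_kron psd_trace_real)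
  qed
  ultimately have "convex hull unit_products \<subseteq> {w :: complex^('a \<times> 'b)^('a \<times> 'b). 0 < Re (trace w)}"
    by (metis hull_minimal)
  then show "0 \<notin> convex hull (unit_products :: (complex^('a \<times> 'b)^('a \<times> 'b)) set)"
    by (auto simp: trace_def)
qed

lemma Re_trace_hermitian_part:
  fixes a k :: "complex^'n^'n"
  assumes "adj k = k"
  shows "Re (trace (((1/2) *\<^sub>R (a + adj a)) ** k)) = a \<bullet> k"
proof -
  have 1: "Re (trace (adj a ** k)) = a \<bullet> k"
  proof -
    have "trace (adj a ** k) = (\<Sum>j\<in>UNIV. \<Sum>i\<in>UNIV. cnj (a $ i $ j) * k $ i $ j)"
      by (simp add: trace_def matrix_matrix_mult_def)
    also have "\<dots> = (\<Sum>i\<in>UNIV. \<Sum>j\<in>UNIV. cnj (a $ i $ j) * k $ i $ j)" by (rule sum.swap)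
    finally show ?thesis by (simp add: inner_vec_def inner_complex_def)
  qed
  have "trace (a ** k) = cnj (trace (adj a ** k))"
    by (simp add: trace_adj[symmetric] adj_mult assms) (rule trace_cyclic)
  then have "Re (trace (a ** k)) = a \<bullet> k" using 1 by simp
  then show ?thesis using 1
    by (simp add: matrix_mul_scaleR matrix_mul_add trace_scaleR trace_add)
qed

lemma outer_axis_nonzero: "outer (axis i 1) (axis i 1) \<noteq> 0"
proof -
  have "outer (axis i 1) (axis i 1) $ i $ i = 1" by (simp add: axis_def)
  then show ?thesis by (metis zero_index zero_neq_one)
qed

theorem min_tensor_bipolar:
  fixes w :: "complex^('a::finite \<times> 'b::finite)^('a \<times> 'b)"
  assumes w: "hermitian w" and pos: "\<And>z. z \<in> PSD_max_tensor \<Longrightarrow> 0 \<le> Re (trace (w ** z))"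
  shows "w \<in> min_tensor PSD PSD"
proof (rule ccontr)
  assume "w \<notin> min_tensor PSD PSD"
  let ?K = "conic hull (convex hull (unit_products :: (complex^('a \<times> 'b)^('a \<times> 'b)) set))"
  have "w \<notin> ?K" using \<open>w \<notin> min_tensor PSD PSD\<close> conic_hull_subset_min_tensor by blast
  moreover have "convex ?K" by (intro convex_conic_hull convex_convex_hull)
  ultimately obtain a b where ab: "a \<bullet> w < b" "\<And>k. k \<in> ?K \<Longrightarrow> b < a \<bullet> k"
    using separating_hyperplane_closed_point closed_conic_hull_unit_products by metis
  have K: "0 \<le> a \<bullet> k" if k: "k \<in> ?K" for k
  proof (rule ccontr)
    assume neg: "\<not> 0 \<le> a \<bullet> k"
    have cone: "b < a \<bullet> (c *\<^sub>R k)" if "0 \<le> c" for c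
      by (intro ab(2) conicD[OF conic_conic_hull k] that)
    have "0 \<le> b / (a \<bullet> k)" using cone[of 0] neg by (simp add: divide_nonpos_neg)
    from cone[OF this] neg show False by simp
  qed
  define z where "z = (1/2) *\<^sub>R (a + adj a)"
  have "z \<in> PSD_max_tensor"
    unfolding PSD_max_tensor_def dual_cone_def
  proof (intro CollectI conjI ballI)
    show "hermitian z" by (simp add: hermitian_iff_adj z_def adj_scaleR adj_add add.commute)
    have "{kron x y | x y. x \<in> PSD \<and> y \<in> PSD} \<subseteq> {y. 0 \<le> Re (trace (z ** y))}"
    proof clarify
      fix x :: "complex^'a^'a" and y :: "complex^'b^'b" assume xy: "x \<in> PSD" "y \<in> PSD"
      then have "Re (trace (z ** kron x y)) = a \<bullet> kron x y"
        unfolding z_def by (intro Re_trace_hermitian_part) (simp add: adj_kron PSD_iff psd_matrix_def hermitian_iff_adj)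
      moreover have "0 \<le> a \<bullet> kron x y"
      proof (cases "x = 0 \<or> y = 0")
        case True
        then have "kron x y = 0" by (auto simp: vec_eq_iff kron_def)
        then show ?thesis by simp
      next
        case False
        then show ?thesis using xy by (intro K kron_in_conic_hull) (auto simp: PSD_iff)
      qed
      ultimately show "0 \<le> Re (trace (z ** kron x y))" by simp
    qed
    moreover have "convex {y. 0 \<le> Re (trace (z ** y))}"
      by (rule convexI) (simp add: matrix_add_ldistrib matrix_mul_scaleR trace_add trace_scaleR)
    ultimately have "min_tensor PSD PSD \<subseteq> {y. 0 \<le> Re (trace (z ** y))}"
      unfolding min_tensor_def by (rule hull_minimal)
    then show "0 \<le> Re (trace (z ** y))" if "y \<in> min_tensor PSD PSD" for y using that by blast
  qed
  then have "0 \<le> Re (trace (z ** w))" using pos by (simp add: trace_cyclic[of z])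
  also have "\<dots> = a \<bullet> w"
    using w unfolding z_def by (intro Re_trace_hermitian_part) (simp add: hermitian_iff_adj)
  finally have "0 < b" using ab(1) by simp
  moreover have "b < 0"
  proof -
    have "kron (outer (axis undefined 1) (axis undefined 1)) (outer (axis undefined 1) (axis undefined 1)) \<in> ?K"
      by (intro kron_in_conic_hull psd_matrix_outer outer_axis_nonzero)
    from conicD[OF conic_conic_hull this, of 0] have "0 \<in> ?K" by simp
    then show ?thesis using ab(2)[of 0] by simp
  qed
  ultimately show False by simp
qed

theorem proposition1p5:
  fixes T S :: "complex^3^3 \<Rightarrow> complex^3^3"
  assumes "complex_linear T" and "complex_linear S"
    and "completely_positive T" and "completely_positive S"
    and "completely_positive (transpose \<circ> T)" and "completely_positive (transpose \<circ> S)"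
  shows "tensor_map T S ` PSD_max_tensor \<subseteq> min_tensor PSD PSD"
proof clarify
  fix x :: "complex^(3 \<times> 3)^(3 \<times> 3)"
  assume x: "x \<in> PSD_max_tensor"
  have T: "ppt_map T" and S: "ppt_map S" using assms completely_positive_ppt_map by auto
  have "hermitian x" using x by (rule PSD_max_tensorD)
  have "cnj (tensor_map T S x $ (c, d) $ (a, b)) = tensor_map T S x $ (a, b) $ (c, d)" for a b c d
  proof -
    have "cnj (F A $ i $ j) = F (adj A) $ j $ i" if "ppt_map F" for F :: "complex^3^3 \<Rightarrow> complex^3^3" and A i j
      using that by (simp add: ppt_map_def)
    then have "cnj (tensor_map T S x $ (c, d) $ (a, b)) =
        (\<Sum>i\<in>UNIV. \<Sum>j\<in>UNIV. T (mat_unit j i) $ a $ c * S (block x j i) $ b $ d)"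
      by (simp add: tensor_map_nth[OF assms(2)] T S adj_mat_unit adj_block[OF \<open>hermitian x\<close>])
    then show ?thesis unfolding tensor_map_nth[OF assms(2)] by (subst sum.swap)
  qed
  then have "hermitian (tensor_map T S x)"
    by (simp add: hermitian_iff_adj vec_eq_iff split_paired_all)
  then show "tensor_map T S x \<in> min_tensor PSD PSD"
    by (rule min_tensor_bipolar) (rule tensor_map_pairing_nonneg[OF assms(1,3,5) S x])
qed

end
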